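(* Let $\mu_S=\sum_{i=1}^n \delta_{x_i}\alpha_i\in V^*$ with $(x_i,\alpha_i)\in\mathcal X\times\mathbb R^p$, and let $v^{\alpha}(x)=\sum_{i=1}^n k(x,x_i)\alpha_i\in V$ be its dual vector-valued function. There is a constant $C>0$, depending only on the target functional and the kernel (and not on $m$ or on the choice of control points), such that the following holds. For $m$ distinct control points $\mathbf c=\{c_1,\dots,c_m\}\subset\{x_1,\dots,x_n\}$ define $$Y_c=(v^{\alpha}(c_1),\dots,v^{\alpha}(c_m))^T\in\mathbb R^{m\times p},\qquad \beta=[\beta_1,\dots,\beta_m]^T=K_{CC}^{-1}Y_c\in\mathbb R^{m\times p},\qquad \hat\mu_S=\sum_{i=1}^m\delta_{c_i}\beta_i .$$ Then $$\|\mu_S-\hat\mu_S\|_{V^*}^2\le C\,\mathrm{tr}(K_{XX}-Q_{XX}),\qquad Q_{XX}=K_{XC}K_{CC}^{-1}K_{CX}.$$ Moreover: 1. If the control points $\mathbf c$ are sampled from the $m$-DPP on the kernel matrix $K_{XX}$, then $$\mathbb E_{\mathbf c}\|\mu_S-\hat\mu_S\|_{V^*}^2\le C(m+1)\sum_{i=m+1}^n\lambda_i(K_{XX}).$$ 2. Fix $\delta\in(0,\tfrac1{32})$ and $S\in\mathbb N$, $S\geq 1$. If the control points are sampled using the recursive ridge leverage score (RLS) scheme with parameters $(S,\delta)$, then with probability at least $1-3\delta$ the number $m$ of control points satisfies $m\le cS\log(S/\delta)$ and $$\|\mu_S-\hat\mu_S\|_{V^*}^2\le\frac{Cn}{S}\sum_{i=S+1}^n\lambda_i(K_{XX}),$$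 where $c>0$ is the absolute constant of the RLS scheme.
   Context: $\mathcal X$ is a non-empty set (with a topology), $p\in\mathbb N$, and $k:\mathcal X\times\mathcal X\to\mathbb R_{\ge0}$ is a symmetric positive-definite kernel, where positive-definite means that the matrix $(k(z_i,z_j))_{ij}$ is positive definite (hence invertible) for pairwise distinct points $z_i$. $V\subset C(\mathcal X,\mathbb R^p)$ is the reproducing kernel Hilbert space (RKHS) of $\mathbb R^p$-valued functions with matrix-valued kernel $K(x,y)=k(x,y)I_p$; $V^*$ is its dual with the dual norm. For $(x,a)\in\mathcal X\times\mathbb R^p$, $\delta_x a\in V^*$ is the functional $(\delta_x a)(v)=a^Tv(x)$; its Riesz representative in $V$ is $k(\cdot,x)a$. $X=\{x_1,\dots,x_n\}$ is a set of $n$ pairwise distinct points of $\mathcal X$. For control points $\mathbf c=\{c_1,\dots,c_m\}$: $K_{XX}=(k(x_i,x_j))\in\mathbb R^{n\times n}$, $K_{XC}=(k(x_i,c_j))\in\mathbb R^{n\times m}$, $K_{CX}=K_{XC}^T$, $K_{CC}=(k(c_i,c_j))\in\mathbb R^{m\times m}$. $\lambda_i(K_{XX})$ is the $i$-th largest eigenvalue of $K_{XX}$ (with multiplicity); empty sums are $0$. The $m$-DPP on $K_{XX}$ is the probability distribution on $m$-element subsets $\mathbf c\subset X$ with $p(\mathbf c)\propto\det(K_{CC})$. The recursive RLS scheme (Algorithm 3 of Musco and Musco) is a randomised procedure which, given $K_{XX}$, $S\in\mathbb N$ and $\delta\in(0,\frac1{32})$, returns a random set of distinct control points $\mathbf c\subset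 X$ of random size $m$. It enters here only through its known guarantee: there is an absolute constant $c>0$ such that with probability at least $1-3\delta$, both $m\le cS\log(S/\delta)$ and $\|K_{XX}-K_{XC}K_{CC}^{-1}K_{CX}\|_2\le\frac1S\sum_{i=S+1}^n\lambda_i(K_{XX})$ hold, with $\|\cdot\|_2$ the spectral norm. *)

theory Defs
  imports
    "HOL-Analysis.Analysis"
    "HOL-Probability.Probability_Mass_Function"
    "Jordan_Normal_Form.DL_Submatrix"
    "Jordan_Normal_Form.Char_Poly"
    "Jordan_Normal_Form.Gauss_Jordan_Elimination"
begin

(* HOL-Analysis and Jordan_Normal_Form share several names.  Unqualified mat and det are those of
   Jordan_Normal_Form (matrices whose dimensions are natural numbers); R^p is real^'p. *)

section \<open>Matrices\<close>

(* Only meaningful for invertible matrices. *)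
definition minv :: "real mat \<Rightarrow> real mat" where
  "minv A = the (mat_inverse A)"

definition mtrace :: "real mat \<Rightarrow> real" where
  "mtrace A = (\<Sum>i<dim_row A. A $$ (i, i))"

definition euclid_norm :: "real Matrix.vec \<Rightarrow> real" where
  "euclid_norm v = sqrt (scalar_prod v v)"

definition spectral_norm :: "real mat \<Rightarrow> real" where
  "spectral_norm A =
     Sup {euclid_norm (A *\<^sub>v v) | v. v \<in> carrier_vec (dim_col A) \<and> euclid_norm v \<le> 1}"

definition pos_def_mat :: "real mat \<Rightarrow> bool" where
  "pos_def_mat A \<longleftrightarrow> square_mat A \<and> transpose_mat A = A \<and>
     (\<forall>v \<in> carrier_vec (dim_row A). v \<noteq> 0\<^sub>v (dim_row A) \<longrightarrow> scalar_prod v (A *\<^sub>v v) > 0)"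

(* The i-th largest eigenvalue, counted with multiplicity, for i = 1, ..., n.  Meant for real
   symmetric n x n matrices, whose characteristic polynomial has n real roots. *)
definition eigval :: "real mat \<Rightarrow> nat \<Rightarrow> real" where
  "eigval A i = rev (sorted_list_of_multiset (proots (char_poly A))) ! (i - 1)"


section \<open>Kernels and reproducing kernel Hilbert spaces\<close>

definition kernel_mat :: "('x \<Rightarrow> 'x \<Rightarrow> real) \<Rightarrow> 'x list \<Rightarrow> 'x list \<Rightarrow> real mat" where
  "kernel_mat k xs ys = mat (length xs) (length ys) (\<lambda>(i, j). k (xs ! i) (ys ! j))"

(* Symmetric, nonnegative-valued, and strictly positive definite. *)
definition pos_def_kernel :: "('x \<Rightarrow> 'x \<Rightarrow> real) \<Rightarrow> bool" where
  "pos_def_kernel k \<longleftrightarrow> (\<forall>x y. 0 \<le> k x y) \<and> (\<forall>x y. k x y = k y x) \<and>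
     (\<forall>zs. distinct zs \<longrightarrow> pos_def_mat (kernel_mat k zs zs))"

(* V with inner product ip is the Hilbert space of R^p-valued functions with reproducing
   kernel K; ip is only relevant on V. *)
locale vector_rkhs =
  fixes V :: "('x \<Rightarrow> real^'p) set"
    and ip :: "('x \<Rightarrow> real^'p) \<Rightarrow> ('x \<Rightarrow> real^'p) \<Rightarrow> real"
    and K :: "'x \<Rightarrow> 'x \<Rightarrow> real^'p^'p"
  assumes zero_mem: "(\<lambda>x. 0) \<in> V"
    and add_mem: "\<lbrakk>f \<in> V; g \<in> V\<rbrakk> \<Longrightarrow> (\<lambda>x. f x + g x) \<in> V"
    and scale_mem: "f \<in> V \<Longrightarrow> (\<lambda>x. r *\<^sub>R f x) \<in> V"
    and ip_commute: "\<lbrakk>f \<in> V; g \<in> V\<rbrakk> \<Longrightarrow> ip f g = ip g f"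
    and ip_add: "\<lbrakk>f \<in> V; g \<in> V; h \<in> V\<rbrakk> \<Longrightarrow> ip (\<lambda>x. f x + g x) h = ip f h + ip g h"
    and ip_scale: "\<lbrakk>f \<in> V; h \<in> V\<rbrakk> \<Longrightarrow> ip (\<lambda>x. r *\<^sub>R f x) h = r * ip f h"
    and ip_nonneg: "f \<in> V \<Longrightarrow> 0 \<le> ip f f"
    and ip_definite: "\<lbrakk>f \<in> V; ip f f = 0\<rbrakk> \<Longrightarrow> f = (\<lambda>x. 0)"
    and complete: "\<lbrakk>\<And>n. F n \<in> V;
        \<And>e. e > 0 \<Longrightarrow> \<exists>N. \<forall>m\<ge>N. \<forall>n\<ge>N.
          sqrt (ip (\<lambda>x. F m x - F n x) (\<lambda>x. F m x - F n x)) < e\<rbrakk>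
      \<Longrightarrow> \<exists>f\<in>V. (\<lambda>n. sqrt (ip (\<lambda>x. F n x - f x) (\<lambda>x. F n x - f x))) \<longlonglongrightarrow> 0"
    and kernel_mem: "(\<lambda>y. K y x *v a) \<in> V"
    and reproducing: "v \<in> V \<Longrightarrow> ip v (\<lambda>y. K y x *v a) = inner a (v x)"

definition scalar_kernel :: "('x \<Rightarrow> 'x \<Rightarrow> real) \<Rightarrow> 'x \<Rightarrow> 'x \<Rightarrow> real^'p^'p" where
  "scalar_kernel k x y = k x y *\<^sub>R Finite_Cartesian_Product.mat 1"

definition dual_norm ::
  "('x \<Rightarrow> real^'p) set \<Rightarrow> (('x \<Rightarrow> real^'p) \<Rightarrow> ('x \<Rightarrow> real^'p) \<Rightarrow> real)
    \<Rightarrow> (('x \<Rightarrow> real^'p) \<Rightarrow> real) \<Rightarrow> real" where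
  "dual_norm V ip L = Sup {\<bar>L v\<bar> | v. v \<in> V \<and> sqrt (ip v v) \<le> 1}"

definition dirac :: "'x \<Rightarrow> real^'p \<Rightarrow> ('x \<Rightarrow> real^'p) \<Rightarrow> real" where
  "dirac x a v = inner a (v x)"

definition dirac_sum :: "'x list \<Rightarrow> (nat \<Rightarrow> real^'p) \<Rightarrow> ('x \<Rightarrow> real^'p) \<Rightarrow> real" where
  "dirac_sum xs \<alpha> v = (\<Sum>i<length xs. dirac (xs ! i) (\<alpha> i) v)"


section \<open>Compression onto control points\<close>

definition dual_fun ::
  "('x \<Rightarrow> 'x \<Rightarrow> real) \<Rightarrow> 'x list \<Rightarrow> (nat \<Rightarrow> real^'p) \<Rightarrow> 'x \<Rightarrow> real^'p" where
  "dual_fun k xs \<alpha> x = (\<Sum>i<length xs. k x (xs ! i) *\<^sub>R \<alpha> i)"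

(* compressed_weights k xs a cs i is the i-th row of K_CC^-1 Y_c, the j-th row of Y_c being
   dual_fun k xs a (cs ! j). *)
definition compressed_weights ::
  "('x \<Rightarrow> 'x \<Rightarrow> real) \<Rightarrow> 'x list \<Rightarrow> (nat \<Rightarrow> real^'p) \<Rightarrow> 'x list \<Rightarrow> nat \<Rightarrow> real^'p" where
  "compressed_weights k xs \<alpha> cs i =
     (\<Sum>j<length cs. minv (kernel_mat k cs cs) $$ (i, j) *\<^sub>R dual_fun k xs \<alpha> (cs ! j))"

definition compressed_functional ::
  "('x \<Rightarrow> 'x \<Rightarrow> real) \<Rightarrow> 'x list \<Rightarrow> (nat \<Rightarrow> real^'p) \<Rightarrow> 'x list
    \<Rightarrow> ('x \<Rightarrow> real^'p) \<Rightarrow> real" where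
  "compressed_functional k xs \<alpha> cs = dirac_sum cs (compressed_weights k xs \<alpha> cs)"

definition Q_mat :: "('x \<Rightarrow> 'x \<Rightarrow> real) \<Rightarrow> 'x list \<Rightarrow> 'x list \<Rightarrow> real mat" where
  "Q_mat k xs cs = kernel_mat k xs cs * minv (kernel_mat k cs cs) * kernel_mat k cs xs"


section \<open>Random control points\<close>

(* Random subsets of X = {x_1, ..., x_n} are given by the random set I of their (0-based) indices;
   the control points are then nths xs I, and K_CC, K_XC, K_CX are the submatrices
   submatrix A I I, submatrix A UNIV I, submatrix A I UNIV of A = K_XX. *)

definition dpp :: "nat \<Rightarrow> real mat \<Rightarrow> nat set pmf" where
  "dpp m A = embed_pmf (\<lambda>I.
     if I \<subseteq> {..<dim_row A} \<and> card I = m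
     then det (submatrix A I I) / (\<Sum>J | J \<subseteq> {..<dim_row A} \<and> card J = m. det (submatrix A J J))
     else 0)"

lemma pmf_dpp:
  assumes nonneg: "\<And>J. \<lbrakk>J \<subseteq> {..<dim_row A}; card J = m\<rbrakk> \<Longrightarrow> 0 \<le> det (submatrix A J J)"
    and pos: "(\<Sum>J | J \<subseteq> {..<dim_row A} \<and> card J = m. det (submatrix A J J)) > 0"
  shows "pmf (dpp m A) I =
    (if I \<subseteq> {..<dim_row A} \<and> card I = m
     then det (submatrix A I I) / (\<Sum>J | J \<subseteq> {..<dim_row A} \<and> card J = m. det (submatrix A J J))
     else 0)"
proof -
  let ?S = "{J. J \<subseteq> {..<dim_row A} \<and> card J = m}"
  let ?Z = "\<Sum>J\<in>?S. det (submatrix A J J)"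
  let ?f = "\<lambda>I. if I \<subseteq> {..<dim_row A} \<and> card I = m then det (submatrix A I I) / ?Z else 0"
  have fin: "finite ?S"
    by (rule finite_subset[of _ "Pow {..<dim_row A}"]) auto
  have nn: "0 \<le> ?f I" for I
    using nonneg pos by auto
  have "(\<integral>\<^sup>+I. ennreal (?f I) \<partial>count_space UNIV) = (\<Sum>I\<in>?S. ennreal (?f I))"
    by (rule nn_integral_count_space'[OF fin]) auto
  also have "\<dots> = ennreal (\<Sum>I\<in>?S. ?f I)"
    by (intro sum_ennreal nn)
  also have "(\<Sum>I\<in>?S. ?f I) = (\<Sum>I\<in>?S. det (submatrix A I I) / ?Z)"
    by (rule sum.cong) auto
  also have "\<dots> = 1"
    using pos by (simp add: sum_divide_distrib[symmetric])
  finally have "(\<integral>\<^sup>+I. ennreal (?f I) \<partial>count_space UNIV) = 1"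
    by simp
  then show ?thesis
    unfolding dpp_def by (intro pmf_embed_pmf nn)
qed

(* rls is a randomised selection procedure: from an n x n matrix A and parameters S, d it returns
   a random index set.  All that is required of it is its guarantee with constant c. *)
definition rls_scheme :: "real \<Rightarrow> (real mat \<Rightarrow> nat \<Rightarrow> real \<Rightarrow> nat set pmf) \<Rightarrow> bool" where
  "rls_scheme c rls \<longleftrightarrow> c > 0 \<and>
     (\<forall>A S \<delta>. pos_def_mat A \<and> 1 \<le> S \<and> 0 < \<delta> \<and> \<delta> < 1 / 32 \<longrightarrow>
        set_pmf (rls A S \<delta>) \<subseteq> Pow {..<dim_row A} \<and>
        measure_pmf.prob (rls A S \<delta>)
          {I. real (card I) \<le> c * real S * ln (real S / \<delta>) \<and>
              spectral_norm
                (A - submatrix A UNIV I * minv (submatrix A I I) * submatrix A I UNIV)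
              \<le> 1 / real S * (\<Sum>i = S + 1..dim_row A. eigval A i)}
          \<ge> 1 - 3 * \<delta>)"

end

theory Submission
  imports Defs
begin

text \<open>
  By the reproducing property the error functional is represented by
  $h = \sum_i k(\cdot, x_i) \alpha_i - \sum_j k(\cdot, c_j) \beta_j$, and $h$ vanishes at the control
  points, so its squared norm is $\sum_{i,l} M_{il} \langle \alpha_i, \alpha_l \rangle$ with
  $M = K_{XX} - Q_{XX}$.  In particular $M$ is positive semidefinite, and the form is at most
  $\sum_i |\alpha_i|^2$ times either the trace or the spectral norm of $M$.  Strict positive
  definiteness makes $\sum_i |\alpha_i|^2$ depend on $\mu$ only, whence the uniform constant.

  For the DPP, $\det(K_{CC}) M_{jj}$ is the principal minor of $K_{XX}$ on $\mathbf c \cup \{x_j\}$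
  (Schur complement), so the expected trace is $(m+1) e_{m+1}(\lambda) / e_m(\lambda)$, sums of
  principal minors being the elementary symmetric polynomials $e_m$ of the eigenvalues.  Finally
  $e_{m+1}(\lambda) \le e_m(\lambda) \sum_{i>m} \lambda_i$: the largest index of an
  $(m+1)$-element set exceeds $m$.
\<close>

section \<open>Principal minors and eigenvalues\<close>

text \<open>The Leibniz formula over an arbitrary finite index set, so that minors of subsets can be
  expanded and compared without renumbering rows and columns.\<close>

definition principal_minor :: "('i \<Rightarrow> 'i \<Rightarrow> 'a::comm_ring_1) \<Rightarrow> 'i set \<Rightarrow> 'a" where
  "principal_minor a J = (\<Sum>p | p permutes J. of_int (sign p) * (\<Prod>i\<in>J. a i (p i)))"

text \<open>Conjugation by \<open>f\<close> carries the permutations of \<open>A\<close> bijectively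
  to those of \<open>B\<close>, keeps the sign and matches the factors of the Leibniz
  products.\<close>

lemma principal_minor_reindex:
  assumes f: "bij_betw f A B" and A: "finite A"
  shows "principal_minor a B = principal_minor (\<lambda>i j. a (f i) (f j)) A"
proof -
  have inj: "inj_on f A" and B: "f ` A = B"
    using f by (auto simp: bij_betw_def)
  have bij: "bij_betw (map_permutation A f) {p. p permutes A} {p. p permutes B}"
  proof (rule bij_betwI')
    fix p q assume p: "p \<in> {p. p permutes A}" and q: "q \<in> {p. p permutes A}"
    show "map_permutation A f p = map_permutation A f q \<longleftrightarrow> p = q"
    proof
      assume eq: "map_permutation A f p = map_permutation A f q"
      show "p = q"
      proof
        fix x
        show "p x = q x"
        proof (cases "x \<in> A")
          case True
          then have "f (p x) = f (q x)"
            using arg_cong[OF eq, of "\<lambda>h. h (f x)"] by (simp add: map_permutation_apply[OF inj])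
          then show ?thesis
            using True p q inj by (auto simp: permutes_in_image dest: inj_onD)
        next
          case False
          then show ?thesis using p q by (simp add: permutes_not_in)
        qed
      qed
    qed simp
  next
    fix p assume "p \<in> {p. p permutes A}"
    then show "map_permutation A f p \<in> {p. p permutes B}"
      using map_permutation_permutes[OF f] by auto
  next
    fix q assume q: "q \<in> {p. p permutes B}"
    let ?g = "inv_into A f"
    have g: "bij_betw ?g B A" by (rule bij_betw_inv_into[OF f])
    have "map_permutation A f (map_permutation B ?g q) = q"
      by (rule map_permutation_compose_inv[OF g]) (use q f in \<open>auto simp: bij_betw_inv_into_right\<close>)
    moreover have "map_permutation B ?g q permutes A"
      using map_permutation_permutes[OF g] q by auto
    ultimately show "\<exists>p\<in>{p. p permutes A}. q = map_permutation A f p" by auto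
  qed
  have "principal_minor a B =
      (\<Sum>p | p permutes A. of_int (sign (map_permutation A f p)) *
         (\<Prod>i\<in>B. a i (map_permutation A f p i)))"
    unfolding principal_minor_def by (rule sum.reindex_bij_betw[OF bij, symmetric])
  also have "\<dots> = principal_minor (\<lambda>i j. a (f i) (f j)) A"
    unfolding principal_minor_def
  proof (intro sum.cong refl)
    fix p assume "p \<in> {p. p permutes A}"
    then have p: "p permutes A" by simp
    have "(\<Prod>i\<in>B. a i (map_permutation A f p i)) = (\<Prod>i\<in>A. a (f i) (map_permutation A f p (f i)))"
      by (rule prod.reindex_bij_betw[OF f, symmetric])
    also have "\<dots> = (\<Prod>i\<in>A. a (f i) (f (p i)))"
      by (intro prod.cong refl) (simp add: map_permutation_apply[OF inj])
    finally show "of_int (sign (map_permutation A f p)) * (\<Prod>i\<in>B. a i (map_permutation A f p i)) =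
        of_int (sign p) * (\<Prod>i\<in>A. a (f i) (f (p i)))"
      by (simp add: sign_map_permutation[OF inj p A])
  qed
  finally show ?thesis .
qed

lemma principal_minor_cong:
  assumes "\<And>i j. i \<in> J \<Longrightarrow> j \<in> J \<Longrightarrow> a i j = b i j"
  shows "principal_minor a J = principal_minor b J"
  unfolding principal_minor_def
  by (intro sum.cong refl arg_cong2[of _ _ _ _ "(*)"] prod.cong assms) (auto simp: permutes_in_image)

lemma det_eq_principal_minor:
  "M \<in> carrier_mat n n \<Longrightarrow> det M = principal_minor (\<lambda>i j. M $$ (i, j)) {..<n}"
  by (simp add: det_def' principal_minor_def lessThan_atLeast0)

text \<open>When each product is expanded, \<open>J\<close> collects the rows that contribute an
  entry of \<open>b\<close>. On the remaining rows the diagonal term is nonzero only at fixed points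
  of \<open>p\<close>, so the sum collapses to the permutations of \<open>J\<close>.\<close>

lemma principal_minor_add_diagonal:
  assumes S: "finite S"
  shows "principal_minor (\<lambda>i j. (if i = j then t else 0) + b i j) S =
    (\<Sum>J\<in>Pow S. t ^ card (S - J) * principal_minor b J)"
proof -
  have "principal_minor (\<lambda>i j. (if i = j then t else 0) + b i j) S =
    (\<Sum>p | p permutes S. of_int (sign p) *
       (\<Sum>J\<in>Pow S. (\<Prod>i\<in>J. b i (p i)) * (\<Prod>i\<in>S-J. if i = p i then t else 0)))"
    unfolding principal_minor_def
    by (subst add.commute, subst prod_add[OF S]) simp
  also have "\<dots> = (\<Sum>J\<in>Pow S. \<Sum>p | p permutes S.
       of_int (sign p) * ((\<Prod>i\<in>J. b i (p i)) * (\<Prod>i\<in>S-J. if i = p i then t else 0)))"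
    by (simp only: sum_distrib_left) (rule sum.swap)
  also have "\<dots> = (\<Sum>J\<in>Pow S. t ^ card (S - J) * principal_minor b J)"
  proof (intro sum.cong refl)
    fix J assume "J \<in> Pow S"
    then have J: "J \<subseteq> S" by simp
    let ?t = "\<lambda>p. of_int (sign p) * ((\<Prod>i\<in>J. b i (p i)) * (\<Prod>i\<in>S-J. if i = p i then t else 0))"
    have "(\<Sum>p | p permutes S. ?t p) = (\<Sum>p | p permutes J. ?t p)"
    proof (rule sum.mono_neutral_right)
      show "finite {p. p permutes S}" by (rule finite_permutations[OF S])
      show "{p. p permutes J} \<subseteq> {p. p permutes S}" using permutes_subset[OF _ J] by auto
      show "\<forall>p\<in>{p. p permutes S} - {p. p permutes J}. ?t p = 0"
      proof
        fix p assume p: "p \<in> {p. p permutes S} - {p. p permutes J}"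
        then obtain i where "i \<in> S - J" "i \<noteq> p i"
          using permutes_superset[of p S J] by fastforce
        then have "(\<Prod>i\<in>S-J. if i = p i then t else 0) = 0"
          using S by (intro prod_zero) auto
        then show "?t p = 0" by simp
      qed
    qed
    also have "\<dots> = (\<Sum>p | p permutes J. t ^ card (S - J) * (of_int (sign p) * (\<Prod>i\<in>J. b i (p i))))"
    proof (intro sum.cong refl)
      fix p assume "p \<in> {p. p permutes J}"
      then have "(\<Prod>i\<in>S-J. if i = p i then t else 0) = (\<Prod>i\<in>S-J. t)"
        by (intro prod.cong) (auto simp: permutes_not_in)
      then show "?t p = t ^ card (S - J) * (of_int (sign p) * (\<Prod>i\<in>J. b i (p i)))"
        by (simp add: algebra_simps)
    qed
    finally show "(\<Sum>p | p permutes S. ?t p) = t ^ card (S - J) * principal_minor b J"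
      by (simp add: principal_minor_def sum_distrib_left)
  qed
  finally show ?thesis .
qed

lemma principal_minor_const_uminus:
  fixes a :: "'a \<Rightarrow> 'a \<Rightarrow> 'b::comm_ring_1"
  assumes "finite J"
  shows "principal_minor (\<lambda>i j. [:- a i j:]) J = [:(-1) ^ card J * principal_minor a J:]"
proof -
  have prod: "(\<Prod>i\<in>J. [:- a i (p i):]) = [:(-1) ^ card J * (\<Prod>i\<in>J. a i (p i)):]" for p
    using assms by (induction J rule: finite_induct) (auto simp: algebra_simps one_pCons)
  have sum: "(\<Sum>p\<in>P. [:f p:]) = [:\<Sum>p\<in>P. f p:]" for f :: "('a \<Rightarrow> 'a) \<Rightarrow> 'b" and P
    by (induction P rule: infinite_finite_induct) auto
  have "principal_minor (\<lambda>i j. [:- a i j:]) J =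
      (\<Sum>p | p permutes J. [:(-1) ^ card J * (of_int (sign p) * (\<Prod>i\<in>J. a i (p i))):])"
    unfolding principal_minor_def prod
    by (intro sum.cong refl) (simp add: of_int_poly mult.left_commute)
  then show ?thesis
    by (simp only: sum principal_minor_def sum_distrib_left)
qed

text \<open>Both expansions of the characteristic polynomial, by minors and by roots, have this
  shape. A set \<open>J\<close> enters only in degree \<open>card S - card J\<close>.\<close>

lemma coeff_sum_Pow_card:
  fixes S :: "'i set" and f :: "'i set \<Rightarrow> 'a::comm_ring_1"
  assumes "finite S" "m \<le> card S"
  shows "coeff (\<Sum>J\<in>Pow S. [:0, 1:] ^ card (S - J) * [:(-1) ^ card J * f J:]) (card S - m)
    = (-1) ^ m * (\<Sum>J | J \<subseteq> S \<and> card J = m. f J)"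
proof -
  have "coeff (\<Sum>J\<in>Pow S. [:0, 1:] ^ card (S - J) * [:(-1) ^ card J * f J:]) (card S - m)
    = (\<Sum>J\<in>Pow S. if card J = m then (-1) ^ m * f J else 0)"
    unfolding coeff_sum
  proof (intro sum.cong refl)
    fix J assume "J \<in> Pow S"
    then have J: "J \<subseteq> S" "finite J" using assms finite_subset by auto
    then have "card J \<le> card S" using assms by (simp add: card_mono)
    moreover have "card (S - J) = card S - card J" using J by (simp add: card_Diff_subset)
    moreover have "([:0, 1:] :: 'a poly) ^ n = monom 1 n" for n
      by (simp add: monom_altdef)
    ultimately show "coeff ([:0, 1:] ^ card (S - J) * [:(-1) ^ card J * f J:]) (card S - m) =
        (if card J = m then (-1) ^ m * f J else 0)"
      using assms(2) by (auto simp: coeff_monom)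
  qed
  also have "\<dots> = (\<Sum>J | J \<subseteq> S \<and> card J = m. (-1) ^ m * f J)"
    using assms(1) by (simp add: sum.If_cases Pow_def Collect_conj_eq)
  finally show ?thesis by (simp add: sum_distrib_left)
qed

text \<open>The coefficient of degree \<open>n - m\<close> of the characteristic polynomial is
  computed twice, from the determinant and from the linear factors. For \<open>m > n\<close> both
  sums are empty.\<close>

lemma sum_principal_minors_eq_elementary_symmetric:
  fixes A :: "'a::comm_ring_1 mat"
  assumes A: "A \<in> carrier_mat n n"
    and split: "char_poly A = (\<Prod>i<n. [:- l i, 1:])"
  shows "(\<Sum>J | J \<subseteq> {..<n} \<and> card J = m. principal_minor (\<lambda>i j. A $$ (i, j)) J)
    = (\<Sum>J | J \<subseteq> {..<n} \<and> card J = m. \<Prod>j\<in>J. l j)"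
proof (cases "m \<le> n")
  case False
  then have no_subsets: "{J. J \<subseteq> {..<n} \<and> card J = m} = {}"
    using card_mono[OF finite_lessThan, of _ n] by auto
  show ?thesis unfolding no_subsets by simp
next
  case m: True
  have c: "char_poly_matrix A \<in> carrier_mat n n" using A by auto
  have "char_poly A = principal_minor (\<lambda>i j. char_poly_matrix A $$ (i, j)) {..<n}"
    unfolding char_poly_def by (rule det_eq_principal_minor[OF c])
  also have "\<dots> = principal_minor (\<lambda>i j. (if i = j then [:0, 1:] else 0) + [:- (A $$ (i, j)):]) {..<n}"
    by (rule principal_minor_cong) (use A in \<open>auto simp: char_poly_matrix_def\<close>)
  also have "\<dots> = (\<Sum>J\<in>Pow {..<n}. [:0, 1:] ^ card ({..<n} - J) *
      [:(-1) ^ card J * principal_minor (\<lambda>i j. A $$ (i, j)) J:])"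
    unfolding principal_minor_add_diagonal[OF finite_lessThan]
    by (intro sum.cong refl) (auto simp: principal_minor_const_uminus finite_subset)
  finally have 1: "coeff (char_poly A) (n - m) =
      (-1) ^ m * (\<Sum>J | J \<subseteq> {..<n} \<and> card J = m. principal_minor (\<lambda>i j. A $$ (i, j)) J)"
    using coeff_sum_Pow_card[of "{..<n}" m] m by simp
  have "(\<Prod>i<n. [:- l i, 1:]) = (\<Prod>i<n. [:- l i:] + [:0, 1:])"
    by (intro prod.cong) auto
  also have "\<dots> = (\<Sum>J\<in>Pow {..<n}. (\<Prod>j\<in>J. [:- l j:]) * (\<Prod>j\<in>{..<n} - J. [:0, 1:]))"
    by (rule prod_add) simp
  also have "\<dots> = (\<Sum>J\<in>Pow {..<n}. [:0, 1:] ^ card ({..<n} - J) * [:(-1) ^ card J * (\<Prod>j\<in>J. l j):])"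
  proof (intro sum.cong refl)
    fix J assume "J \<in> Pow {..<n}"
    then have "finite J" by (auto intro: finite_subset)
    then have "(\<Prod>j\<in>J. [:- l j:]) = [:(-1) ^ card J * (\<Prod>j\<in>J. l j):]"
      by (induction J rule: finite_induct) (auto simp: algebra_simps one_pCons)
    then show "(\<Prod>j\<in>J. [:- l j:]) * (\<Prod>j\<in>{..<n} - J. [:0, 1:]) =
        [:0, 1:] ^ card ({..<n} - J) * [:(-1) ^ card J * (\<Prod>j\<in>J. l j):]"
      by (simp add: mult.commute)
  qed
  finally have 2: "coeff (\<Prod>i<n. [:- l i, 1:]) (n - m) =
      (-1) ^ m * (\<Sum>J | J \<subseteq> {..<n} \<and> card J = m. \<Prod>j\<in>J. l j)"
    using coeff_sum_Pow_card[of "{..<n}" m] m by simp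
  \<comment> \<open>The common sign is cancelled by multiplying with it once more, the entries lying
    in a commutative ring.\<close>
  have sq: "x = (-1) ^ m * ((-1) ^ m * x)" for x :: 'a
    by (simp flip: mult.assoc power_mult_distrib)
  show ?thesis
    by (subst (1 2) sq) (simp only: 1[symmetric] 2[symmetric] split)
qed

text \<open>Removing the maximum maps the sets of size \<open>Suc m\<close> injectively to pairs of
  a set of size \<open>m\<close> and an index. That index is at least \<open>m\<close>, because
  \<open>J\<close> has \<open>Suc m\<close> elements and lies in \<open>{..Max J}\<close>. The pairs
  outside the image contribute nonnegative terms.\<close>

lemma elementary_symmetric_Suc_le:
  fixes l :: "nat \<Rightarrow> real"
  assumes l: "\<And>i. i < n \<Longrightarrow> 0 \<le> l i"
  shows "(\<Sum>J | J \<subseteq> {..<n} \<and> card J = Suc m. \<Prod>j\<in>J. l j)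
    \<le> (\<Sum>J | J \<subseteq> {..<n} \<and> card J = m. \<Prod>j\<in>J. l j) * (\<Sum>i=m..<n. l i)"
proof -
  let ?P = "\<lambda>m. {J. J \<subseteq> {..<n} \<and> card J = m}"
  let ?g = "\<lambda>J. (J - {Max J}, Max J)"
  have fin: "finite (?P m)" for m
    by (rule finite_subset[of _ "Pow {..<n}"]) auto
  have J: "finite J" "J \<noteq> {}" "Max J \<in> J" "Max J < n" "m \<le> Max J" if "J \<in> ?P (Suc m)" for J
  proof -
    show f: "finite J" using that by (auto intro: finite_subset)
    show ne: "J \<noteq> {}" using that by auto
    show M: "Max J \<in> J" using f ne by simp
    then show "Max J < n" using that by auto
    have "J \<subseteq> {..Max J}" using f by auto
    then have "card J \<le> card {..Max J}" by (rule card_mono[rotated]) simp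
    then show "m \<le> Max J" using that by simp
  qed
  have inj: "inj_on ?g (?P (Suc m))"
  proof (rule inj_onI)
    fix I J' assume I: "I \<in> ?P (Suc m)" and J': "J' \<in> ?P (Suc m)" and eq: "?g I = ?g J'"
    have "I = insert (Max I) (I - {Max I})" "J' = insert (Max J') (J' - {Max J'})"
      using J(3)[OF I] J(3)[OF J'] by auto
    moreover have "Max I = Max J'" "I - {Max I} = J' - {Max J'}" using eq by auto
    ultimately show "I = J'" by metis
  qed
  have "(\<Sum>J\<in>?P (Suc m). \<Prod>j\<in>J. l j) = (\<Sum>J\<in>?P (Suc m). (\<lambda>(I, i). (\<Prod>j\<in>I. l j) * l i) (?g J))"
    using J by (intro sum.cong refl) (simp add: prod.remove[where x = "Max _"] mult.commute)
  also have "\<dots> = (\<Sum>x\<in>?g ` ?P (Suc m). (\<lambda>(I, i). (\<Prod>j\<in>I. l j) * l i) x)"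
    by (simp add: sum.reindex[OF inj] o_def)
  also have "\<dots> \<le> (\<Sum>x\<in>?P m \<times> {m..<n}. (\<lambda>(I, i). (\<Prod>j\<in>I. l j) * l i) x)"
  proof (rule sum_mono2)
    show "finite (?P m \<times> {m..<n})" using fin by simp
    show "?g ` ?P (Suc m) \<subseteq> ?P m \<times> {m..<n}"
    proof (rule image_subsetI)
      fix J assume "J \<in> ?P (Suc m)"
      with J[OF this] show "?g J \<in> ?P m \<times> {m..<n}" by auto
    qed
    show "0 \<le> (\<lambda>(I, i). (\<Prod>j\<in>I. l j) * l i) x" if "x \<in> ?P m \<times> {m..<n} - ?g ` ?P (Suc m)" for x
      using that l by (auto intro!: mult_nonneg_nonneg prod_nonneg)
  qed
  also have "\<dots> = (\<Sum>J\<in>?P m. \<Prod>j\<in>J. l j) * (\<Sum>i=m..<n. l i)"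
    by (simp add: sum.cartesian_product sum_product)
  finally show ?thesis .
qed

section \<open>Real spectrum of symmetric matrices, positivity for positive definite ones\<close>

lemma symmetric_real_complex_eigenvalue_real:
  fixes A :: "real mat"
  assumes A: "A \<in> carrier_mat n n" and sym: "transpose_mat A = A"
    and ev: "eigenvalue (map_mat complex_of_real A) z"
  shows "z \<in> \<real>"
proof -
  obtain v where v: "v \<in> carrier_vec n" "v \<noteq> 0\<^sub>v n"
    and Av: "map_mat complex_of_real A *\<^sub>v v = z \<cdot>\<^sub>v v"
    using ev A by (auto simp: eigenvalue_def eigenvector_def)
  have sym': "A $$ (i, j) = A $$ (j, i)" if "i < n" "j < n" for i j
    using that A arg_cong[OF sym, of "\<lambda>M. M $$ (i, j)"] by simp
  have row: "(\<Sum>j<n. complex_of_real (A $$ (i, j)) * v $ j) = z * v $ i" if "i < n" for i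
    using arg_cong[OF Av, of "\<lambda>w. w $ i"] that A v
    by (simp add: scalar_prod_def lessThan_atLeast0)
  define N where "N = (\<Sum>i<n. (cmod (v $ i))\<^sup>2)"
  \<comment> \<open>\<open>S\<close> is the Hermitian form of \<open>A\<close> at the eigenvector
    \<open>v\<close>. It equals \<open>z * N\<close>, and by symmetry of \<open>A\<close> it equals
    its own conjugate; both \<open>S\<close> and \<open>N\<close> are therefore real.\<close>
  define S where "S = (\<Sum>i<n. \<Sum>j<n. cnj (v $ i) * (complex_of_real (A $$ (i, j)) * v $ j))"
  have "S = (\<Sum>i<n. cnj (v $ i) * (z * v $ i))"
    unfolding S_def by (intro sum.cong refl) (simp add: sum_distrib_left[symmetric] row)
  also have "\<dots> = z * complex_of_real N"
    unfolding N_def of_real_sum sum_distrib_left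
    by (intro sum.cong refl) (simp add: complex_norm_square[unfolded of_real_power] mult_ac)
  finally have S: "S = z * complex_of_real N" .
  have "cnj S = (\<Sum>i<n. \<Sum>j<n. v $ i * (complex_of_real (A $$ (i, j)) * cnj (v $ j)))"
    by (simp add: S_def)
  also have "\<dots> = (\<Sum>j<n. \<Sum>i<n. v $ i * (complex_of_real (A $$ (i, j)) * cnj (v $ j)))"
    by (rule sum.swap)
  also have "\<dots> = S"
    unfolding S_def by (intro sum.cong refl) (simp add: sym' mult_ac)
  finally have "S \<in> \<real>" by (simp add: Reals_cnj_iff)
  moreover have "N \<noteq> 0"
  proof -
    obtain i where i: "i < n" "v $ i \<noteq> 0" using v by (metis eq_vecI carrier_vecD index_zero_vec)
    have "0 < (cmod (v $ i))\<^sup>2" using i by simp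
    also have "\<dots> \<le> N" unfolding N_def by (rule member_le_sum) (use i in auto)
    finally show ?thesis by simp
  qed
  moreover have "z = S / complex_of_real N"
    using S \<open>N \<noteq> 0\<close> by simp
  ultimately show ?thesis
    by (metis Reals_divide Reals_of_real)
qed

text \<open>Over the complex numbers the polynomial splits, and its roots are real because they are
  eigenvalues of a symmetric matrix. The factorization is pulled back along the injective embedding
  of the reals.\<close>

lemma char_poly_symmetric_splits:
  fixes A :: "real mat"
  assumes A: "A \<in> carrier_mat n n" and sym: "transpose_mat A = A"
  shows "\<exists>rs. char_poly A = (\<Prod>r\<leftarrow>rs. [:- r, 1:]) \<and> length rs = n"
proof -
  interpret of_real_poly: map_poly_inj_idom_hom complex_of_real ..
  let ?c = "map_mat complex_of_real A"
  have c: "?c \<in> carrier_mat n n" using A by simp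
  obtain as where as: "char_poly ?c = (\<Prod>a\<leftarrow>as. [:- a, 1:])" "length as = n"
    using char_poly_factorized[OF c] by auto
  have re: "complex_of_real (Re a) = a" if "a \<in> set as" for a
  proof -
    have "poly (char_poly ?c) a = 0"
      using that unfolding as by (auto simp: poly_prod_list prod_list_zero_iff)
    then have "eigenvalue ?c a" using eigenvalue_root_char_poly[OF c] by simp
    then show ?thesis
      using symmetric_real_complex_eigenvalue_real[OF A sym] by (simp add: of_real_Re)
  qed
  have "map_poly complex_of_real (char_poly A) = char_poly ?c"
    by (rule of_real_hom.char_poly_hom[OF A, symmetric])
  also have "\<dots> = (\<Prod>a\<leftarrow>as. [:- complex_of_real (Re a), 1:])"
    unfolding as by (intro arg_cong[of _ _ prod_list] map_cong refl) (simp add: re)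
  also have "\<dots> = map_poly complex_of_real (\<Prod>a\<leftarrow>as. [:- Re a, 1:])"
    by (induction as) (simp_all add: hom_distribs)
  finally have "char_poly A = (\<Prod>a\<leftarrow>as. [:- Re a, 1:])"
    by simp
  then show ?thesis
    using as(2) by (intro exI[of _ "map Re as"]) (simp add: o_def)
qed

lemma pos_def_mat_eigenvalue_pos:
  assumes "pos_def_mat A" "eigenvalue A r"
  shows "0 < r"
proof -
  obtain v where v: "v \<in> carrier_vec (dim_row A)" "v \<noteq> 0\<^sub>v (dim_row A)" and Av: "A *\<^sub>v v = r \<cdot>\<^sub>v v"
    using assms(2) by (auto simp: eigenvalue_def eigenvector_def)
  have "0 < scalar_prod v (A *\<^sub>v v)"
    using assms(1) v by (auto simp: pos_def_mat_def)
  also have "\<dots> = r * scalar_prod v v"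
    using v by (simp add: Av)
  finally show ?thesis
    using sum_nonneg[of "{0..<dim_vec v}" "\<lambda>i. v $ i * v $ i"]
    by (auto simp: scalar_prod_def zero_less_mult_iff)
qed

text \<open>Since the polynomial splits, its multiset of real roots has exactly \<open>n\<close>
  elements. The sorted list behind \<open>eigval\<close> is then a permutation of the linear
  factors, and every index below \<open>n\<close> hits a genuine root.\<close>

lemma char_poly_eq_prod_eigval:
  assumes A: "A \<in> carrier_mat n n" and sym: "transpose_mat A = A"
  shows "char_poly A = (\<Prod>i<n. [:- eigval A (Suc i), 1:])"
    and "i < n \<Longrightarrow> eigenvalue A (eigval A (Suc i))"
proof -
  obtain rs where rs: "char_poly A = (\<Prod>r\<leftarrow>rs. [:- r, 1:])" "length rs = n"
    using char_poly_symmetric_splits[OF A sym] by auto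
  define ls where "ls = rev (sorted_list_of_multiset (proots (char_poly A)))"
  have "proots (\<Prod>r\<leftarrow>rs. [:- r, 1:]) = mset rs" for rs :: "real list"
  proof (induction rs)
    case (Cons r rs)
    have "(\<Prod>r\<leftarrow>rs. [:- r, 1:]) \<noteq> 0" by (auto simp: prod_list_zero_iff)
    then show ?case using Cons by (simp add: proots_mult del: mult_pCons_left)
  qed simp
  then have ls: "mset ls = mset rs" by (simp add: ls_def rs)
  then have len: "length ls = n" using rs(2) by (metis size_mset)
  have ev: "eigval A (Suc i) = ls ! i" for i
    by (simp add: eigval_def ls_def)
  have "char_poly A = (\<Prod>r\<in>#mset rs. [:- r, 1:])"
    unfolding rs by (simp flip: mset_map prod_mset_prod_list)
  also have "\<dots> = (\<Prod>r\<leftarrow>ls. [:- r, 1:])"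
    by (simp flip: ls mset_map prod_mset_prod_list)
  finally have cp: "char_poly A = (\<Prod>r\<leftarrow>ls. [:- r, 1:])" .
  then show "char_poly A = (\<Prod>i<n. [:- eigval A (Suc i), 1:])"
    by (simp add: prod.list_conv_set_nth len ev lessThan_atLeast0)
  show "eigenvalue A (eigval A (Suc i))" if "i < n"
  proof -
    have "poly (char_poly A) (ls ! i) = 0"
      unfolding cp using that len by (auto simp: poly_prod_list prod_list_zero_iff)
    then show ?thesis
      using eigenvalue_root_char_poly[OF A] by (simp add: ev)
  qed
qed

lemma pos_def_matD:
  assumes "pos_def_mat A"
  shows "A \<in> carrier_mat (dim_row A) (dim_row A)" "transpose_mat A = A"
  using assms by (auto simp: pos_def_mat_def)

lemma pos_def_mat_eigval_pos:
  assumes "pos_def_mat A" "i < dim_row A"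
  shows "0 < eigval A (Suc i)"
  using assms pos_def_mat_eigenvalue_pos char_poly_eq_prod_eigval(2) pos_def_matD by blast

text \<open>The determinant is the only principal minor of full size, so the case
  \<open>m = n\<close> of the identity for minor sums makes it the product of the positive
  eigenvalues.\<close>

lemma pos_def_mat_det_pos:
  assumes "pos_def_mat A"
  shows "0 < det A"
proof -
  let ?n = "dim_row A"
  note A = pos_def_matD[OF assms]
  have J: "{J. J \<subseteq> {..<?n} \<and> card J = ?n} = {{..<?n}}"
    using card_subset_eq[OF finite_lessThan, of _ ?n] by auto
  have "det A = (\<Sum>J | J \<subseteq> {..<?n} \<and> card J = ?n. principal_minor (\<lambda>i j. A $$ (i, j)) J)"
    by (simp add: J det_eq_principal_minor[OF A(1)])
  also have "\<dots> = (\<Prod>i<?n. eigval A (Suc i))"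
    by (subst sum_principal_minors_eq_elementary_symmetric[OF A(1)
          char_poly_eq_prod_eigval(1)[OF A]]) (simp add: J)
  also have "\<dots> > 0"
    using pos_def_mat_eigval_pos[OF assms] by (intro prod_pos) auto
  finally show ?thesis .
qed

section \<open>Inverses and Schur complements\<close>

text \<open>A nonzero determinant makes \<open>A\<close> a unit of the matrix ring, so
  \<open>mat_inverse\<close> returns a value and \<open>the\<close> in \<open>minv\<close> is well
  defined.\<close>

lemma minv_inverse:
  assumes A: "A \<in> carrier_mat n n" and det: "det A \<noteq> 0"
  shows "minv A \<in> carrier_mat n n" "A * minv A = 1\<^sub>m n" "minv A * A = 1\<^sub>m n"
proof -
  have "A \<in> Units (ring_mat TYPE(real) n ())"
    by (rule det_non_zero_imp_unit[OF A det])
  then obtain B where "mat_inverse A = Some B"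
    using mat_inverse(1)[OF A, where b = "()"] by (cases "mat_inverse A") auto
  with mat_inverse(2)[OF A this]
  show "minv A \<in> carrier_mat n n" "A * minv A = 1\<^sub>m n" "minv A * A = 1\<^sub>m n"
    by (auto simp: minv_def)
qed

text \<open>Block elimination: the bordered matrix is a lower block triangular matrix of determinant
  1 times an upper one whose last corner is the Schur complement of \<open>A\<close>.\<close>

lemma det_bordered:
  assumes A: "A \<in> carrier_mat n n" and det: "det A \<noteq> 0"
    and B: "B \<in> carrier_mat n 1" and C: "C \<in> carrier_mat 1 n" and D: "D \<in> carrier_mat 1 1"
  shows "det (four_block_mat A B C D) = det A * (D - C * minv A * B) $$ (0, 0)"
proof -
  note inv = minv_inverse[OF A det]
  let ?L = "four_block_mat (1\<^sub>m n) (0\<^sub>m n 1) (C * minv A) (1\<^sub>m 1)"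
  let ?U = "four_block_mat A B (0\<^sub>m 1 n) (D - C * minv A * B)"
  have CI: "C * minv A \<in> carrier_mat 1 n" using C inv by simp
  have S: "D - C * minv A * B \<in> carrier_mat 1 1" by (rule minus_carrier_mat[OF mult_carrier_mat[OF CI B]])
  have CA: "C * minv A * A = C"
    using C inv A by (simp add: assoc_mult_mat[of _ 1 n _ n _ n])
  have LU: "?L * ?U = four_block_mat A B C D"
    using A B C D CI S
    by (subst mult_four_block_mat[OF one_carrier_mat zero_carrier_mat CI one_carrier_mat A B zero_carrier_mat S])
       (auto simp: CA)
  have "det (four_block_mat A B C D) = det ?L * det ?U"
    unfolding LU[symmetric]
    by (rule det_mult[OF four_block_carrier_mat[OF one_carrier_mat one_carrier_mat] four_block_carrier_mat[OF A S]])
  also have "det ?L = 1"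
    by (subst det_four_block_mat_upper_right_zero[OF one_carrier_mat refl CI one_carrier_mat]) simp
  also have "det ?U = det A * det (D - C * minv A * B)"
    by (rule det_four_block_mat_lower_left_zero[OF A B refl S])
  also have "det (D - C * minv A * B) = (D - C * minv A * B) $$ (0, 0)"
    using S by (simp add: det_single)
  finally show ?thesis by simp
qed

section \<open>Kernel matrices and quadratic forms\<close>

lemma kernel_mat_carrier [simp]: "kernel_mat k xs ys \<in> carrier_mat (length xs) (length ys)"
  by (simp add: kernel_mat_def)

lemma kernel_mat_dim [simp]:
  "dim_row (kernel_mat k xs ys) = length xs" "dim_col (kernel_mat k xs ys) = length ys"
  by (simp_all add: kernel_mat_def)

lemma kernel_mat_index [simp]:
  "i < length xs \<Longrightarrow> j < length ys \<Longrightarrow> kernel_mat k xs ys $$ (i, j) = k (xs ! i) (ys ! j)"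
  by (simp add: kernel_mat_def)

text \<open>Translates between the index sets returned by the random schemes and the lists of
  control points.\<close>

lemma submatrix_kernel_mat:
  "submatrix (kernel_mat k xs ys) I J = kernel_mat k (nths xs I) (nths ys J)"
  by (rule eq_matI) (auto simp: dim_submatrix length_nths submatrix_index nth_nths pick_le)

lemma pos_def_kernel_mat: "pos_def_kernel k \<Longrightarrow> distinct zs \<Longrightarrow> pos_def_mat (kernel_mat k zs zs)"
  by (simp add: pos_def_kernel_def)

lemma index_mult_mat_sum:
  assumes "A \<in> carrier_mat n m" "B \<in> carrier_mat m p" "i < n" "j < p"
  shows "(A * B) $$ (i, j) = (\<Sum>l<m. A $$ (i, l) * B $$ (l, j))"
  using assms by (simp add: scalar_prod_def lessThan_atLeast0)

lemma Q_mat_carrier: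
  assumes "minv (kernel_mat k cs cs) \<in> carrier_mat (length cs) (length cs)"
  shows "Q_mat k xs cs \<in> carrier_mat (length xs) (length xs)"
  unfolding Q_mat_def by (intro mult_carrier_mat[OF mult_carrier_mat[OF _ assms]]) simp_all

lemma Q_mat_index:
  assumes P: "minv (kernel_mat k cs cs) \<in> carrier_mat (length cs) (length cs)"
    and i: "i < length xs" and l: "l < length xs"
  shows "Q_mat k xs cs $$ (i, l) =
    (\<Sum>a<length cs. \<Sum>b<length cs. k (xs ! i) (cs ! a) * minv (kernel_mat k cs cs) $$ (a, b) * k (cs ! b) (xs ! l))"
proof -
  let ?m = "length cs"
  have KP: "kernel_mat k xs cs * minv (kernel_mat k cs cs) \<in> carrier_mat (length xs) ?m"
    by (rule mult_carrier_mat[OF _ P]) simp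
  have "Q_mat k xs cs $$ (i, l) =
     (\<Sum>b<?m. (\<Sum>a<?m. k (xs ! i) (cs ! a) * minv (kernel_mat k cs cs) $$ (a, b)) * k (cs ! b) (xs ! l))"
    unfolding Q_mat_def index_mult_mat_sum[OF KP kernel_mat_carrier i l]
    by (intro sum.cong refl)
       (simp add: index_mult_mat_sum[OF kernel_mat_carrier P i] i l)
  also have "\<dots> = (\<Sum>a<?m. \<Sum>b<?m. k (xs ! i) (cs ! a) * minv (kernel_mat k cs cs) $$ (a, b) * k (cs ! b) (xs ! l))"
    unfolding sum_distrib_right by (rule sum.swap)
  finally show ?thesis .
qed

section \<open>Trace and spectral norm bounds for quadratic forms with vector weights\<close>

lemma psd_form_le_trace:
  fixes M :: "nat \<Rightarrow> nat \<Rightarrow> real" and \<alpha> :: "nat \<Rightarrow> 'a::real_inner"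
  assumes psd: "\<And>w. 0 \<le> (\<Sum>i<n. \<Sum>l<n. M i l * (w i * w l))"
  shows "(\<Sum>i<n. \<Sum>l<n. M i l * inner (\<alpha> i) (\<alpha> l)) \<le> (\<Sum>i<n. M i i) * (\<Sum>i<n. (norm (\<alpha> i))\<^sup>2)"
proof -
  (* Testing the form on two coordinates, with weights |alpha_l| and +-|alpha_i|, bounds each
     pair of symmetric off-diagonal terms by diagonal ones. *)
  have two: "0 \<le> s\<^sup>2 * M i i + s * t * (M i l + M l i) + t\<^sup>2 * M l l" if "i < n" "l < n" for s t i l
  proof -
    have "(\<Sum>j<n. \<Sum>m<n. M j m * (((if j = i then s else 0) + (if j = l then t else 0)) *
           ((if m = i then s else 0) + (if m = l then t else 0)))) =
        s\<^sup>2 * M i i + s * t * (M i l + M l i) + t\<^sup>2 * M l l"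
      using that
      by (simp add: algebra_simps sum.distrib if_distrib[of "\<lambda>x. _ * x"] if_distrib[of "\<lambda>x. x * _"] power2_eq_square cong: if_cong)
    with psd[of "\<lambda>j. (if j = i then s else 0) + (if j = l then t else 0)"] show ?thesis by simp
  qed
  have pair: "(M i l + M l i) * inner (\<alpha> i) (\<alpha> l) \<le> M i i * (norm (\<alpha> l))\<^sup>2 + M l l * (norm (\<alpha> i))\<^sup>2"
    if "i < n" "l < n" for i l
  proof -
    let ?s = "norm (\<alpha> l)" and ?t = "norm (\<alpha> i)"
    have "(M i l + M l i) * inner (\<alpha> i) (\<alpha> l) \<le> \<bar>M i l + M l i\<bar> * \<bar>inner (\<alpha> i) (\<alpha> l)\<bar>"
      by (metis abs_ge_self abs_mult)
    also have "\<dots> \<le> \<bar>M i l + M l i\<bar> * (?t * ?s)"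
      by (intro mult_left_mono Cauchy_Schwarz_ineq2) simp
    also have "\<dots> \<le> M i i * ?s\<^sup>2 + M l l * ?t\<^sup>2"
      using two[OF that, of ?s ?t] two[OF that, of ?s "- ?t"]
      by (auto simp: abs_if algebra_simps)
    finally show ?thesis .
  qed
  \<comment> \<open>Adding the same sum with the indices swapped produces the symmetric pairs of
    off-diagonal terms that \<open>pair\<close> bounds.\<close>
  have "2 * (\<Sum>i<n. \<Sum>l<n. M i l * inner (\<alpha> i) (\<alpha> l)) =
      (\<Sum>i<n. \<Sum>l<n. M i l * inner (\<alpha> i) (\<alpha> l)) + (\<Sum>i<n. \<Sum>l<n. M l i * inner (\<alpha> l) (\<alpha> i))"
    unfolding mult_2 by (intro arg_cong2[of _ _ _ _ "(+)"] refl sum.swap)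
  also have "\<dots> = (\<Sum>i<n. \<Sum>l<n. (M i l + M l i) * inner (\<alpha> i) (\<alpha> l))"
    unfolding sum.distrib[symmetric] distrib_right by (simp only: inner_commute)
  also have "\<dots> \<le> (\<Sum>i<n. \<Sum>l<n. M i i * (norm (\<alpha> l))\<^sup>2 + M l l * (norm (\<alpha> i))\<^sup>2)"
    by (intro sum_mono pair) auto
  also have "\<dots> = (\<Sum>i<n. \<Sum>l<n. M i i * (norm (\<alpha> l))\<^sup>2) + (\<Sum>l<n. \<Sum>i<n. M l l * (norm (\<alpha> i))\<^sup>2)"
    unfolding sum.distrib by (intro arg_cong2[of _ _ _ _ "(+)"] refl sum.swap)
  also have "\<dots> = 2 * ((\<Sum>i<n. M i i) * (\<Sum>i<n. (norm (\<alpha> i))\<^sup>2))"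
    by (simp only: sum_product mult_2)
  finally show ?thesis by simp
qed

lemma euclid_norm_eq_L2_set: "euclid_norm v = L2_set (\<lambda>i. v $ i) {..<dim_vec v}"
  by (simp add: euclid_norm_def L2_set_def scalar_prod_def power2_eq_square lessThan_atLeast0)

text \<open>Coordinates of a vector in the unit ball are at most 1 in absolute value, so the sum of
  the absolute entries of \<open>A\<close> is a bound. Boundedness is what makes the real supremum
  in \<open>spectral_norm\<close> an actual upper bound.\<close>

lemma bdd_above_spectral_norm:
  fixes A :: "real mat"
  shows "bdd_above {euclid_norm (A *\<^sub>v v) | v. v \<in> carrier_vec (dim_col A) \<and> euclid_norm v \<le> 1}"
proof (rule bdd_aboveI, clarify)
  fix v :: "real Matrix.vec"
  assume v: "v \<in> carrier_vec (dim_col A)" and n: "euclid_norm v \<le> 1"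
  have le: "\<bar>v $ j\<bar> \<le> 1" if "j < dim_col A" for j
  proof -
    have "\<bar>v $ j\<bar> \<le> L2_set (\<lambda>i. v $ i) {..<dim_vec v}"
      using member_le_L2_set[of "{..<dim_vec v}" j "\<lambda>i. \<bar>v $ i\<bar>"] that v
      by (simp add: L2_set_def)
    then show ?thesis using n by (simp add: euclid_norm_eq_L2_set)
  qed
  have "euclid_norm (A *\<^sub>v v) \<le> (\<Sum>i<dim_row A. \<bar>(A *\<^sub>v v) $ i\<bar>)"
    unfolding euclid_norm_eq_L2_set by (rule order_trans[OF L2_set_le_sum_abs]) simp
  also have "\<dots> \<le> (\<Sum>i<dim_row A. \<Sum>j<dim_col A. \<bar>A $$ (i, j)\<bar>)"
  proof (rule sum_mono)
    fix i assume "i \<in> {..<dim_row A}"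
    then have "\<bar>(A *\<^sub>v v) $ i\<bar> = \<bar>\<Sum>j<dim_col A. A $$ (i, j) * v $ j\<bar>"
      using v by (simp add: scalar_prod_def lessThan_atLeast0)
    also have "\<dots> \<le> (\<Sum>j<dim_col A. \<bar>A $$ (i, j)\<bar> * \<bar>v $ j\<bar>)"
      by (rule order_trans[OF sum_abs]) (simp add: abs_mult)
    also have "\<dots> \<le> (\<Sum>j<dim_col A. \<bar>A $$ (i, j)\<bar>)"
      by (intro sum_mono mult_left_le le) auto
    finally show "\<bar>(A *\<^sub>v v) $ i\<bar> \<le> (\<Sum>j<dim_col A. \<bar>A $$ (i, j)\<bar>)" .
  qed
  finally show "euclid_norm (A *\<^sub>v v) \<le> (\<Sum>i<dim_row A. \<Sum>j<dim_col A. \<bar>A $$ (i, j)\<bar>)" .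
qed

lemma euclid_norm_smult: "euclid_norm (c \<cdot>\<^sub>v v) = \<bar>c\<bar> * euclid_norm v"
  by (simp add: euclid_norm_def real_sqrt_mult power2_eq_square[symmetric] flip: mult.assoc)

lemma euclid_norm_mult_mat_le:
  assumes v: "v \<in> carrier_vec (dim_col A)"
  shows "euclid_norm (A *\<^sub>v v) \<le> spectral_norm A * euclid_norm v"
proof (cases "euclid_norm v = 0")
  case True
  then have "v = 0\<^sub>v (dim_col A)"
    using v by (auto simp: euclid_norm_eq_L2_set L2_set_eq_0_iff intro!: eq_vecI)
  then have "A *\<^sub>v v = 0\<^sub>v (dim_row A)"
    by (intro eq_vecI) (auto simp: scalar_prod_def)
  then show ?thesis using True by (simp add: euclid_norm_def)
next
  case False
  then have pos: "0 < euclid_norm v"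
    by (simp add: euclid_norm_eq_L2_set less_le)
  let ?w = "(1 / euclid_norm v) \<cdot>\<^sub>v v"
  have w: "?w \<in> carrier_vec (dim_col A)" "euclid_norm ?w \<le> 1"
    using v pos by (auto simp: euclid_norm_smult)
  have "euclid_norm (A *\<^sub>v ?w) \<le> spectral_norm A"
    unfolding spectral_norm_def
    by (rule cSup_upper[OF _ bdd_above_spectral_norm]) (use w in auto)
  also have "A *\<^sub>v ?w = (1 / euclid_norm v) \<cdot>\<^sub>v (A *\<^sub>v v)"
    by (rule mult_mat_vec[OF _ v]) auto
  finally show ?thesis
    using pos by (simp add: euclid_norm_smult field_simps)
qed

text \<open>The form splits into one scalar form for each coordinate of the weights. Each of these
  is bounded by Cauchy-Schwarz and the operator norm inequality, and the squares add up to the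
  squared Euclidean norms.\<close>

lemma form_le_spectral_norm:
  fixes M :: "real mat" and \<alpha> :: "nat \<Rightarrow> real^'p"
  assumes M: "M \<in> carrier_mat n n"
  shows "(\<Sum>i<n. \<Sum>l<n. M $$ (i, l) * inner (\<alpha> i) (\<alpha> l)) \<le> spectral_norm M * (\<Sum>i<n. (norm (\<alpha> i))\<^sup>2)"
proof -
  have scalar: "(\<Sum>i<n. \<Sum>l<n. M $$ (i, l) * (a i * a l)) \<le> spectral_norm M * (\<Sum>i<n. (a i)\<^sup>2)" for a
  proof -
    let ?v = "Matrix.vec n a"
    have v: "?v \<in> carrier_vec (dim_col M)" using M by simp
    have Mv: "(M *\<^sub>v ?v) $ i = (\<Sum>l<n. M $$ (i, l) * a l)" if "i < n" for i
      using that M by (simp add: scalar_prod_def lessThan_atLeast0)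
    have "(\<Sum>i<n. \<Sum>l<n. M $$ (i, l) * (a i * a l)) = (\<Sum>i<n. a i * (M *\<^sub>v ?v) $ i)"
      by (intro sum.cong refl) (simp add: Mv sum_distrib_left mult_ac del: index_mult_mat_vec)
    also have "\<dots> \<le> (\<Sum>i<n. \<bar>a i\<bar> * \<bar>(M *\<^sub>v ?v) $ i\<bar>)"
      by (intro sum_mono) (metis abs_ge_self abs_mult)
    also have "\<dots> \<le> L2_set a {..<n} * L2_set (\<lambda>i. (M *\<^sub>v ?v) $ i) {..<n}"
      by (rule L2_set_mult_ineq)
    also have "\<dots> = euclid_norm ?v * euclid_norm (M *\<^sub>v ?v)"
      using M by (auto simp: euclid_norm_eq_L2_set intro!: arg_cong2[of _ _ _ _ "(*)"] L2_set_cong)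
    also have "\<dots> \<le> euclid_norm ?v * (spectral_norm M * euclid_norm ?v)"
      by (intro mult_left_mono euclid_norm_mult_mat_le v) (simp add: euclid_norm_eq_L2_set)
    also have "\<dots> = spectral_norm M * (euclid_norm ?v)\<^sup>2"
      by (simp add: power2_eq_square)
    also have "(euclid_norm ?v)\<^sup>2 = (\<Sum>i<n. (a i)\<^sup>2)"
      by (simp add: euclid_norm_eq_L2_set L2_set_def sum_nonneg)
    finally show ?thesis .
  qed
  have "(\<Sum>i<n. \<Sum>l<n. M $$ (i, l) * inner (\<alpha> i) (\<alpha> l)) =
      (\<Sum>i<n. \<Sum>l<n. \<Sum>d\<in>UNIV. M $$ (i, l) * (\<alpha> i $ d * \<alpha> l $ d))"
    by (simp add: inner_vec_def sum_distrib_left)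
  also have "\<dots> = (\<Sum>i<n. \<Sum>d\<in>UNIV. \<Sum>l<n. M $$ (i, l) * (\<alpha> i $ d * \<alpha> l $ d))"
    by (intro sum.cong refl sum.swap)
  also have "\<dots> = (\<Sum>d\<in>UNIV. \<Sum>i<n. \<Sum>l<n. M $$ (i, l) * (\<alpha> i $ d * \<alpha> l $ d))"
    by (rule sum.swap)
  also have "\<dots> \<le> (\<Sum>d\<in>UNIV. spectral_norm M * (\<Sum>i<n. (\<alpha> i $ d)\<^sup>2))"
    by (intro sum_mono scalar)
  also have "\<dots> = spectral_norm M * (\<Sum>i<n. \<Sum>d\<in>UNIV. (\<alpha> i $ d)\<^sup>2)"
    unfolding sum_distrib_left[symmetric] by (subst sum.swap) (rule refl)
  also have "\<dots> = spectral_norm M * (\<Sum>i<n. (norm (\<alpha> i))\<^sup>2)"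
    by (simp add: norm_vec_def L2_set_def sum_nonneg)
  finally show ?thesis .
qed

section \<open>The approximation error in the reproducing kernel Hilbert space\<close>

text \<open>The coefficient that a weighted point list gives to a point, zero off the list. It lets
  functionals written over different lists be compared point by point.\<close>

definition coef :: "'x list \<Rightarrow> (nat \<Rightarrow> 'a::comm_monoid_add) \<Rightarrow> 'x \<Rightarrow> 'a" where
  "coef xs \<alpha> z = (\<Sum>i | i < length xs \<and> xs ! i = z. \<alpha> i)"

lemma coef_nth:
  assumes "distinct xs" "i < length xs"
  shows "coef xs \<alpha> (xs ! i) = \<alpha> i"
proof -
  have "{j. j < length xs \<and> xs ! j = xs ! i} = {i}"
    using assms by (auto simp: nth_eq_iff_index_eq)
  then show ?thesis by (simp add: coef_def)
qed

lemma coef_notin: "z \<notin> set xs \<Longrightarrow> coef xs \<alpha> z = 0"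
  by (auto simp: coef_def intro: sum.neutral)

text \<open>Moves a sum over one list to a larger common set of points; the added points have
  coefficient 0, where \<open>g\<close> vanishes.\<close>

lemma sum_coef:
  fixes g :: "'x \<Rightarrow> 'a::comm_monoid_add \<Rightarrow> 'b::comm_monoid_add"
  assumes xs: "distinct xs" "set xs \<subseteq> set zs" and g0: "\<And>z. g z 0 = 0"
  shows "(\<Sum>i<length xs. g (xs ! i) (\<gamma> i)) = (\<Sum>z\<in>set zs. g z (coef xs \<gamma> z))"
proof -
  have "(\<Sum>i<length xs. g (xs ! i) (\<gamma> i)) = (\<Sum>i<length xs. (\<lambda>z. g z (coef xs \<gamma> z)) (xs ! i))"
    using xs by (intro sum.cong) (auto simp: coef_nth)
  also have "\<dots> = (\<Sum>z\<in>set xs. g z (coef xs \<gamma> z))"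
    by (rule sum.reindex_bij_betw) (use xs in \<open>auto intro: bij_betw_nth\<close>)
  also have "\<dots> = (\<Sum>z\<in>set zs. g z (coef xs \<gamma> z))"
    using xs by (intro sum.mono_neutral_left) (auto simp: coef_notin g0)
  finally show ?thesis .
qed

locale scalar_rkhs = vector_rkhs V ip "scalar_kernel k"
  for V :: "('x \<Rightarrow> real^'p) set" and ip and k :: "'x \<Rightarrow> 'x \<Rightarrow> real" +
  assumes pos_def: "pos_def_kernel k"
begin

section \<open>Inner product calculus and the dual norm\<close>

lemma scalar_kernel_mult: "scalar_kernel k y x *v (a :: real^'p) = k y x *\<^sub>R a"
  by (simp add: scalar_kernel_def scaleR_matrix_vector_assoc[symmetric])

lemma kernel_section_mem: "(\<lambda>y. k y x *\<^sub>R a) \<in> V"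
  using kernel_mem[of x a] by (simp add: scalar_kernel_mult)

lemma kernel_section_reproducing: "v \<in> V \<Longrightarrow> ip v (\<lambda>y. k y x *\<^sub>R a) = inner a (v x)"
  using reproducing[of v x a] by (simp add: scalar_kernel_mult)

lemma diff_mem: "f \<in> V \<Longrightarrow> g \<in> V \<Longrightarrow> (\<lambda>x. f x - g x) \<in> V"
  using add_mem[OF _ scale_mem[of g "-1"], of f] by simp

lemma ip_diff_left:
  assumes "f \<in> V" "g \<in> V" "h \<in> V"
  shows "ip (\<lambda>x. f x - g x) h = ip f h - ip g h"
  using ip_add[OF assms(1) scale_mem[OF assms(2), of "-1"] assms(3)] ip_scale[OF assms(2,3), of "-1"]
  by simp

lemma ip_diff_right:
  assumes "f \<in> V" "g \<in> V" "h \<in> V"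
  shows "ip h (\<lambda>x. f x - g x) = ip h f - ip h g"
  using assms by (simp add: ip_commute[of h] diff_mem ip_diff_left)

text \<open>Subtracting from \<open>f\<close> its projection onto \<open>g\<close> leaves a function
  of nonnegative squared norm. If \<open>ip g g = 0\<close>, definiteness forces \<open>g\<close> to
  vanish.\<close>

lemma ip_Cauchy_Schwarz:
  assumes f: "f \<in> V" and g: "g \<in> V"
  shows "\<bar>ip f g\<bar> \<le> sqrt (ip f f) * sqrt (ip g g)"
proof (cases "ip g g = 0")
  case True
  then have "g = (\<lambda>x. 0 *\<^sub>R g x)" using ip_definite[OF g] by simp
  then have "ip g f = 0" using ip_scale[OF g f, of 0] by simp
  then show ?thesis using ip_commute[OF f g] True by simp
next
  case False
  then have pos: "0 < ip g g" using ip_nonneg[OF g] by simp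
  define t where "t = ip f g / ip g g"
  have tg: "(\<lambda>x. t *\<^sub>R g x) \<in> V" by (rule scale_mem[OF g])
  have "0 \<le> ip (\<lambda>x. f x - t *\<^sub>R g x) (\<lambda>x. f x - t *\<^sub>R g x)"
    by (rule ip_nonneg[OF diff_mem[OF f tg]])
  also have "\<dots> = ip f f - ip f (\<lambda>x. t *\<^sub>R g x) - (ip (\<lambda>x. t *\<^sub>R g x) f - ip (\<lambda>x. t *\<^sub>R g x) (\<lambda>x. t *\<^sub>R g x))"
    using f tg by (simp add: ip_diff_left ip_diff_right diff_mem)
  also have "\<dots> = ip f f - 2 * t * ip f g + t\<^sup>2 * ip g g"
    using f g tg
    by (simp add: ip_commute[OF f tg] ip_commute[OF g tg] ip_scale ip_commute[OF g f] power2_eq_square)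
  also have "\<dots> = ip f f - (ip f g)\<^sup>2 / ip g g"
    using pos by (simp add: t_def power2_eq_square)
  finally have "(ip f g)\<^sup>2 \<le> ip f f * ip g g"
    using pos by (simp add: field_simps)
  then show ?thesis
    by (metis real_sqrt_abs real_sqrt_le_mono real_sqrt_mult)
qed

text \<open>Cauchy-Schwarz makes \<open>sqrt (ip h h)\<close> an upper bound of the set defining the
  dual norm. Squaring requires the supremum to be nonnegative; the zero function, which lies in the
  unit ball, provides a member of the set to compare with.\<close>

lemma dual_norm_riesz_le:
  assumes h: "h \<in> V" and L: "\<And>v. v \<in> V \<Longrightarrow> L v = ip v h"
  shows "(dual_norm V ip L)\<^sup>2 \<le> ip h h"
proof -
  let ?S = "{\<bar>L v\<bar> | v. v \<in> V \<and> sqrt (ip v v) \<le> 1}"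
  have le: "s \<le> sqrt (ip h h)" if "s \<in> ?S" for s
  proof -
    from that obtain v where v: "s = \<bar>L v\<bar>" "v \<in> V" "sqrt (ip v v) \<le> 1" by blast
    have "s \<le> sqrt (ip v v) * sqrt (ip h h)"
      using ip_Cauchy_Schwarz[OF v(2) h] v L by simp
    also have "\<dots> \<le> sqrt (ip h h)"
      using v(3) ip_nonneg[OF h] by (intro mult_left_le_one_le) (simp_all add: ip_nonneg v(2))
    finally show ?thesis .
  qed
  have "ip (\<lambda>x. 0) (\<lambda>x. 0) = 0"
    using ip_scale[OF zero_mem zero_mem, of 0] by simp
  then have mem: "\<bar>L (\<lambda>x. 0)\<bar> \<in> ?S"
    using zero_mem by force
  have "bdd_above ?S" by (rule bdd_aboveI[OF le])
  then have "0 \<le> dual_norm V ip L"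
    unfolding dual_norm_def by (rule cSup_upper2[OF mem abs_ge_zero])
  moreover have "dual_norm V ip L \<le> sqrt (ip h h)"
    unfolding dual_norm_def by (rule cSup_least) (use mem le in blast)+
  ultimately have "(dual_norm V ip L)\<^sup>2 \<le> (sqrt (ip h h))\<^sup>2"
    by (rule power_mono[rotated])
  then show ?thesis using ip_nonneg[OF h] by simp
qed

lemma sum_sections_mem: "(\<lambda>y. \<Sum>i<n::nat. k y (x i) *\<^sub>R a i) \<in> V"
proof (induction n)
  case 0
  show ?case using zero_mem by simp
next
  case (Suc n)
  show ?case using add_mem[OF Suc kernel_section_mem] by simp
qed

lemma ip_sum_sections:
  assumes v: "v \<in> V"
  shows "ip v (\<lambda>y. \<Sum>i<n::nat. k y (x i) *\<^sub>R a i) = (\<Sum>i<n. inner (a i) (v (x i)))"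
proof (induction n)
  case 0
  have "ip (\<lambda>x. 0) v = 0" using ip_scale[OF zero_mem v, of 0] by simp
  then show ?case using ip_commute[OF v zero_mem] by simp
next
  case (Suc n)
  let ?s = "\<lambda>y. \<Sum>i<n. k y (x i) *\<^sub>R a i"
  have "ip v (\<lambda>y. ?s y + k y (x n) *\<^sub>R a n) = ip v ?s + ip v (\<lambda>y. k y (x n) *\<^sub>R a n)"
    using v sum_sections_mem kernel_section_mem
    by (simp add: ip_commute[of v] add_mem ip_add)
  then show ?case
    using Suc kernel_section_reproducing[OF v] by simp
qed

lemma dual_fun_mem: "dual_fun k xs \<alpha> \<in> V"
  using sum_sections_mem[where x = "\<lambda>i. xs ! i"] by (simp add: dual_fun_def[abs_def])

lemma ip_dual_fun: "v \<in> V \<Longrightarrow> ip v (dual_fun k xs \<alpha>) = dirac_sum xs \<alpha> v"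
  using ip_sum_sections[where x = "\<lambda>i. xs ! i"]
  by (simp add: dual_fun_def[abs_def] dirac_sum_def dirac_def)

lemma minv_kernel_mat:
  assumes "distinct cs"
  shows "minv (kernel_mat k cs cs) \<in> carrier_mat (length cs) (length cs)"
    "kernel_mat k cs cs * minv (kernel_mat k cs cs) = 1\<^sub>m (length cs)"
    "minv (kernel_mat k cs cs) * kernel_mat k cs cs = 1\<^sub>m (length cs)"
  using minv_inverse[OF kernel_mat_carrier, of k cs]
    pos_def_mat_det_pos[OF pos_def_kernel_mat[OF pos_def assms]] by auto

section \<open>The Riesz representative of the error and its squared norm\<close>

definition residual_fun :: "'x list \<Rightarrow> (nat \<Rightarrow> real^'p) \<Rightarrow> 'x list \<Rightarrow> 'x \<Rightarrow> real^'p" where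
  "residual_fun xs \<alpha> cs x = dual_fun k xs \<alpha> x - dual_fun k cs (compressed_weights k xs \<alpha> cs) x"

lemma residual_fun_mem: "residual_fun xs \<alpha> cs \<in> V"
  using diff_mem[OF dual_fun_mem dual_fun_mem] by (simp add: residual_fun_def[abs_def])

lemma ip_residual_fun:
  "v \<in> V \<Longrightarrow> ip v (residual_fun xs \<alpha> cs) = dirac_sum xs \<alpha> v - compressed_functional k xs \<alpha> cs v"
  by (simp add: residual_fun_def[abs_def] ip_diff_right dual_fun_mem ip_dual_fun compressed_functional_def)

text \<open>The compressed function interpolates: its values at the control points are the kernel
  matrix times its inverse applied to the values of the original dual function.\<close>

lemma residual_fun_control_point:
  assumes cs: "distinct cs" and j: "j < length cs"
  shows "residual_fun xs \<alpha> cs (cs ! j) = 0"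
proof -
  let ?m = "length cs" and ?y = "\<lambda>b. dual_fun k xs \<alpha> (cs ! b)"
  let ?P = "minv (kernel_mat k cs cs)"
  note P = minv_kernel_mat[OF cs]
  have "dual_fun k cs (compressed_weights k xs \<alpha> cs) (cs ! j) =
      (\<Sum>a<?m. \<Sum>b<?m. (k (cs ! j) (cs ! a) * ?P $$ (a, b)) *\<^sub>R ?y b)"
    by (simp add: dual_fun_def[of k cs] compressed_weights_def scaleR_sum_right)
  also have "\<dots> = (\<Sum>b<?m. (\<Sum>a<?m. k (cs ! j) (cs ! a) * ?P $$ (a, b)) *\<^sub>R ?y b)"
    by (subst sum.swap) (simp add: scaleR_sum_left)
  also have "\<dots> = (\<Sum>b<?m. (if j = b then 1 else 0) *\<^sub>R ?y b)"
  proof (intro sum.cong refl)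
    fix b assume b: "b \<in> {..<?m}"
    then have "(\<Sum>a<?m. k (cs ! j) (cs ! a) * ?P $$ (a, b)) = (kernel_mat k cs cs * ?P) $$ (j, b)"
      using j by (subst index_mult_mat_sum[OF kernel_mat_carrier P(1)]) auto
    also have "\<dots> = (if j = b then 1 else 0)"
      using b j by (simp add: P(2))
    finally show "(\<Sum>a<?m. k (cs ! j) (cs ! a) * ?P $$ (a, b)) *\<^sub>R ?y b = (if j = b then 1 else 0) *\<^sub>R ?y b"
      by simp
  qed
  also have "\<dots> = ?y j"
    using j by (simp add: if_distrib[of "\<lambda>c. c *\<^sub>R _"] cong: if_cong)
  finally show ?thesis by (simp add: residual_fun_def)
qed

lemma residual_fun_point:
  assumes cs: "distinct cs" and i: "i < length xs"
  shows "residual_fun xs \<alpha> cs (xs ! i) =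
    (\<Sum>l<length xs. (kernel_mat k xs xs - Q_mat k xs cs) $$ (i, l) *\<^sub>R \<alpha> l)"
proof -
  let ?m = "length cs" and ?n = "length xs"
  let ?P = "minv (kernel_mat k cs cs)"
  note P = minv_kernel_mat[OF cs]
  have "dual_fun k cs (compressed_weights k xs \<alpha> cs) (xs ! i) =
      (\<Sum>a<?m. \<Sum>b<?m. \<Sum>l<?n. (k (xs ! i) (cs ! a) * ?P $$ (a, b) * k (cs ! b) (xs ! l)) *\<^sub>R \<alpha> l)"
    by (simp add: dual_fun_def compressed_weights_def scaleR_sum_right mult.assoc)
  also have "\<dots> = (\<Sum>a<?m. \<Sum>l<?n. \<Sum>b<?m. (k (xs ! i) (cs ! a) * ?P $$ (a, b) * k (cs ! b) (xs ! l)) *\<^sub>R \<alpha> l)"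
    by (intro sum.cong refl sum.swap)
  also have "\<dots> = (\<Sum>l<?n. \<Sum>a<?m. \<Sum>b<?m. (k (xs ! i) (cs ! a) * ?P $$ (a, b) * k (cs ! b) (xs ! l)) *\<^sub>R \<alpha> l)"
    by (rule sum.swap)
  also have "\<dots> = (\<Sum>l<?n. Q_mat k xs cs $$ (i, l) *\<^sub>R \<alpha> l)"
    by (intro sum.cong refl) (simp add: Q_mat_index[OF P(1) i] scaleR_sum_left)
  finally have "residual_fun xs \<alpha> cs (xs ! i) =
      (\<Sum>l<?n. k (xs ! i) (xs ! l) *\<^sub>R \<alpha> l) - (\<Sum>l<?n. Q_mat k xs cs $$ (i, l) *\<^sub>R \<alpha> l)"
    by (simp add: residual_fun_def dual_fun_def[of k xs])
  also have "\<dots> = (\<Sum>l<?n. (kernel_mat k xs xs - Q_mat k xs cs) $$ (i, l) *\<^sub>R \<alpha> l)"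
    unfolding sum_subtractf[symmetric]
    by (intro sum.cong refl)
       (use i Q_mat_carrier[OF P(1), of xs] in \<open>auto simp: scaleR_diff_left\<close>)
  finally show ?thesis .
qed

text \<open>Pairing the residual with itself evaluates the error functional at the residual. The
  compressed part drops out because the residual vanishes at the control points, and its values at
  the data points give the matrix form.\<close>

lemma ip_residual_fun_self:
  assumes cs: "distinct cs"
  shows "ip (residual_fun xs \<alpha> cs) (residual_fun xs \<alpha> cs) =
    (\<Sum>i<length xs. \<Sum>l<length xs. (kernel_mat k xs xs - Q_mat k xs cs) $$ (i, l) * inner (\<alpha> i) (\<alpha> l))"
  unfolding ip_residual_fun[OF residual_fun_mem] compressed_functional_def dirac_sum_def dirac_def
  by (simp add: residual_fun_control_point[OF cs] residual_fun_point[OF cs] inner_sum_right del: index_minus_mat)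

lemma error_sq_le_form:
  assumes cs: "distinct cs" and \<mu>: "\<And>v. v \<in> V \<Longrightarrow> \<mu> v = dirac_sum xs \<alpha> v"
  shows "(dual_norm V ip (\<lambda>v. \<mu> v - compressed_functional k xs \<alpha> cs v))\<^sup>2 \<le>
    (\<Sum>i<length xs. \<Sum>l<length xs. (kernel_mat k xs xs - Q_mat k xs cs) $$ (i, l) * inner (\<alpha> i) (\<alpha> l))"
  unfolding ip_residual_fun_self[OF cs, symmetric]
  by (rule dual_norm_riesz_le[OF residual_fun_mem]) (simp add: ip_residual_fun \<mu>)

text \<open>With weights \<open>w i *\<^sub>R e\<close> along one unit vector \<open>e\<close>, the
  form is a squared norm in \<open>V\<close>. Any coordinate axis serves as
  \<open>e\<close>.\<close>

lemma residual_mat_psd: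
  assumes cs: "distinct cs"
  shows "0 \<le> (\<Sum>i<length xs. \<Sum>l<length xs. (kernel_mat k xs xs - Q_mat k xs cs) $$ (i, l) * (w i * w l))"
proof -
  define e :: "real^'p" where "e = axis undefined 1"
  have "inner (w i *\<^sub>R e) (w l *\<^sub>R e) = w i * w l" for i l
    by (simp add: e_def inner_axis_axis)
  then show ?thesis
    using ip_nonneg[OF residual_fun_mem[of xs "\<lambda>i. w i *\<^sub>R e" cs]]
    by (simp only: ip_residual_fun_self[OF cs])
qed

lemma mtrace_residual:
  assumes cs: "distinct cs"
  shows "mtrace (kernel_mat k xs xs - Q_mat k xs cs) =
    (\<Sum>i<length xs. (kernel_mat k xs xs - Q_mat k xs cs) $$ (i, i))"
proof -
  have "dim_row (kernel_mat k xs xs - Q_mat k xs cs) = length xs"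
    using Q_mat_carrier[OF minv_kernel_mat(1)[OF cs], of xs] by auto
  then show ?thesis by (simp only: mtrace_def)
qed

text \<open>Diagonal entries are values of the positive semidefinite form at coordinate vectors. The
  sign permits replacing the squared coefficient sum by a larger constant.\<close>

lemma mtrace_residual_nonneg:
  assumes cs: "distinct cs"
  shows "0 \<le> mtrace (kernel_mat k xs xs - Q_mat k xs cs)"
  unfolding mtrace_residual[OF cs]
proof (rule sum_nonneg)
  fix i assume i: "i \<in> {..<length xs}"
  let ?M = "kernel_mat k xs xs - Q_mat k xs cs"
  have "(\<Sum>l<length xs. ?M $$ (j, l) * ((if j = i then 1 else 0) * (if l = i then 1 else 0))) =
      (if j = i then ?M $$ (i, i) else 0)" for j
    using i by (cases "j = i") (simp_all add: if_distrib[of "\<lambda>x. _ * x"] cong: if_cong del: index_minus_mat)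
  then show "0 \<le> ?M $$ (i, i)"
    using residual_mat_psd[OF cs, of xs "\<lambda>j. if j = i then 1 else 0"] i
    by (simp del: index_minus_mat)
qed

lemma error_sq_le_trace:
  assumes cs: "distinct cs" and \<mu>: "\<And>v. v \<in> V \<Longrightarrow> \<mu> v = dirac_sum xs \<alpha> v"
  shows "(dual_norm V ip (\<lambda>v. \<mu> v - compressed_functional k xs \<alpha> cs v))\<^sup>2 \<le>
    mtrace (kernel_mat k xs xs - Q_mat k xs cs) * (\<Sum>i<length xs. (norm (\<alpha> i))\<^sup>2)"
  unfolding mtrace_residual[OF cs]
  by (rule order_trans[OF error_sq_le_form[OF assms] psd_form_le_trace[OF residual_mat_psd[OF cs]]])

lemma error_sq_le_spectral_norm:
  assumes cs: "distinct cs" and \<mu>: "\<And>v. v \<in> V \<Longrightarrow> \<mu> v = dirac_sum xs \<alpha> v"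
  shows "(dual_norm V ip (\<lambda>v. \<mu> v - compressed_functional k xs \<alpha> cs v))\<^sup>2 \<le>
    spectral_norm (kernel_mat k xs xs - Q_mat k xs cs) * (\<Sum>i<length xs. (norm (\<alpha> i))\<^sup>2)"
  by (rule order_trans[OF error_sq_le_form[OF assms] form_le_spectral_norm])
     (simp_all add: minus_carrier_mat Q_mat_carrier minv_kernel_mat(1)[OF cs])

section \<open>Linear independence of kernel sections and uniqueness of coefficients\<close>

text \<open>If some coordinate \<open>d\<close> of some coefficient were nonzero, the vector of all
  \<open>d\<close>-th coordinates would be a nonzero vector annihilated by the kernel matrix,
  against strict positive definiteness.\<close>

lemma sum_sections_eq_0D:
  assumes xs: "distinct xs" and zero: "\<And>y. y \<in> set xs \<Longrightarrow> (\<Sum>i<length xs. k y (xs ! i) *\<^sub>R (\<gamma> i :: real^'p)) = 0"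
    and i: "i < length xs"
  shows "\<gamma> i = 0"
proof (rule ccontr)
  assume "\<gamma> i \<noteq> 0"
  then obtain d where d: "\<gamma> i $ d \<noteq> 0" by (auto simp: Finite_Cartesian_Product.vec_eq_iff)
  let ?v = "Matrix.vec (length xs) (\<lambda>i. \<gamma> i $ d)"
  have "kernel_mat k xs xs *\<^sub>v ?v = 0\<^sub>v (length xs)"
  proof (rule eq_vecI)
    fix j assume "j < dim_vec (0\<^sub>v (length xs) :: real Matrix.vec)"
    then have j: "j < length xs" by simp
    have "(\<Sum>i<length xs. k (xs ! j) (xs ! i) * \<gamma> i $ d) = (\<Sum>i<length xs. k (xs ! j) (xs ! i) *\<^sub>R \<gamma> i) $ d"
      by (simp add: sum_component)
    also have "\<dots> = 0" using zero[of "xs ! j"] j by simp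
    finally show "(kernel_mat k xs xs *\<^sub>v ?v) $ j = 0\<^sub>v (length xs) $ j"
      using j by (simp add: scalar_prod_def flip: lessThan_atLeast0)
  qed simp
  moreover have "?v \<noteq> 0\<^sub>v (length xs)"
    using d i by (metis index_vec index_zero_vec(1))
  ultimately show False
    using pos_def_kernel_mat[OF pos_def xs] by (auto simp: pos_def_mat_def)
qed

text \<open>Makes the constant of the theorem depend on the functional alone. Equal functionals have
  equal dual functions, so over the union of both point lists all coefficients agree; a point
  missing from one list has coefficient 0 in the other.\<close>

lemma sum_norm_coefficients_unique:
  assumes xs: "distinct xs" and ys: "distinct ys"
    and eq: "\<And>v. v \<in> V \<Longrightarrow> dirac_sum xs \<alpha> v = dirac_sum ys \<beta> v"
  shows "(\<Sum>i<length xs. (norm (\<alpha> i))\<^sup>2) = (\<Sum>i<length ys. (norm (\<beta> i))\<^sup>2)"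
proof -
  define zs where "zs = remdups (xs @ ys)"
  have zs: "distinct zs" "set xs \<subseteq> set zs" "set ys \<subseteq> set zs" by (simp_all add: zs_def)
  have "coef xs \<alpha> (zs ! i) - coef ys \<beta> (zs ! i) = 0" if i: "i < length zs" for i
  proof (rule sum_sections_eq_0D[OF zs(1) _ i])
    fix y assume "y \<in> set zs"
    have "inner e (dual_fun k xs \<alpha> y) = inner e (dual_fun k ys \<beta> y)" for e :: "real^'p"
    proof -
      \<comment> \<open>Evaluating the functional at the kernel section at \<open>y\<close> recovers
        the component along \<open>e\<close> of its dual function at \<open>y\<close>.\<close>
      let ?s = "\<lambda>z. k z y *\<^sub>R e"
      have "inner e (dual_fun k us \<gamma> y) = dirac_sum us \<gamma> ?s" for us \<gamma>
        using kernel_section_reproducing[OF dual_fun_mem] ip_dual_fun[OF kernel_section_mem]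
          ip_commute[OF dual_fun_mem kernel_section_mem] by metis
      then show ?thesis using eq[OF kernel_section_mem] by simp
    qed
    then have "dual_fun k xs \<alpha> y = dual_fun k ys \<beta> y"
      by (metis vector_eq_ldot inner_commute)
    moreover have dual_fun: "dual_fun k us \<gamma> y = (\<Sum>i<length zs. k y (zs ! i) *\<^sub>R coef us \<gamma> (zs ! i))"
      if "distinct us" "set us \<subseteq> set zs" for us \<gamma>
      unfolding dual_fun_def
      by (subst sum_coef[OF that, where g = "\<lambda>z a. k y z *\<^sub>R a"], simp)
         (rule sum.reindex_bij_betw[OF bij_betw_nth[OF zs(1) refl refl], symmetric])
    ultimately show "(\<Sum>i<length zs. k y (zs ! i) *\<^sub>R (coef xs \<alpha> (zs ! i) - coef ys \<beta> (zs ! i))) = 0"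
      using dual_fun[OF xs zs(2), of \<alpha>] dual_fun[OF ys zs(3), of \<beta>]
      by (simp add: scaleR_diff_right sum_subtractf)
  qed
  then have "coef xs \<alpha> z = coef ys \<beta> z" if "z \<in> set zs" for z
    using that by (metis in_set_conv_nth eq_iff_diff_eq_0)
  then show ?thesis
    using sum_coef[OF xs zs(2), where g = "\<lambda>z a. (norm a)\<^sup>2" and \<gamma> = \<alpha>]
      sum_coef[OF ys zs(3), where g = "\<lambda>z a. (norm a)\<^sup>2" and \<gamma> = \<beta>]
    by simp
qed

end

section \<open>The expected trace under the determinantal point process\<close>

text \<open>Appending \<open>x\<close> borders the kernel matrix by one row and one column; the
  second factor on the left is the resulting Schur complement.\<close>

lemma det_kernel_mat_snoc:
  assumes P: "pos_def_mat (kernel_mat k cs cs)"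
  shows "det (kernel_mat k cs cs) * (k x x - (\<Sum>a<length cs. \<Sum>b<length cs.
      k x (cs ! a) * minv (kernel_mat k cs cs) $$ (a, b) * k (cs ! b) x)) =
    det (kernel_mat k (cs @ [x]) (cs @ [x]))"
proof -
  let ?K = "kernel_mat k cs cs" and ?m = "length cs"
  have det: "det ?K \<noteq> 0" using pos_def_mat_det_pos[OF P] by simp
  note I = minv_inverse[OF kernel_mat_carrier det]
  have blocks: "kernel_mat k (cs @ [x]) (cs @ [x]) =
      four_block_mat ?K (kernel_mat k cs [x]) (kernel_mat k [x] cs) (kernel_mat k [x] [x])"
    by (rule eq_matI) (auto simp: nth_append less_Suc_eq)
  have "(kernel_mat k [x] [x] - Q_mat k [x] cs) $$ (0, 0) = k x x - (\<Sum>a<?m. \<Sum>b<?m.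
      k x (cs ! a) * minv ?K $$ (a, b) * k (cs ! b) x)"
    using Q_mat_carrier[OF I(1), of "[x]"] Q_mat_index[OF I(1), of 0 "[x]" 0] by simp
  then show ?thesis
    unfolding blocks
    using det_bordered[OF kernel_mat_carrier det, of "kernel_mat k cs [x]" "kernel_mat k [x] cs" "kernel_mat k [x] [x]"]
    by (simp add: Q_mat_def kernel_mat_carrier[of k cs "[x]", simplified] kernel_mat_carrier[of k "[x]" cs, simplified]
        kernel_mat_carrier[of k "[x]" "[x]", simplified])
qed

lemma pick_bij_betw:
  assumes "finite I"
  shows "bij_betw (pick I) {..<card I} I"
proof -
  have "inj_on (pick I) {..<card I}"
  proof (rule linorder_inj_onI)
    fix x y assume "x < y" "x \<in> {..<card I}" "y \<in> {..<card I}"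
    then have "pick I x < pick I y" by (intro pick_mono_le) auto
    then show "pick I x \<noteq> pick I y" by simp
  qed auto
  moreover have "pick I ` {..<card I} \<subseteq> I"
    using pick_in_set_le by auto
  ultimately show ?thesis
    using assms by (simp add: bij_betw_def card_subset_eq card_image)
qed

lemma nths_conv_map_pick:
  assumes "I \<subseteq> {..<length xs}"
  shows "nths xs I = map (\<lambda>i. xs ! pick I i) [0..<card I]"
proof -
  have "{i. i < length xs \<and> i \<in> I} = I" using assms by auto
  then show ?thesis
    by (intro nth_equalityI) (auto simp: length_nths nth_nths)
qed

text \<open>Every enumeration of \<open>J\<close> yields the same determinant, by invariance of
  principal minors under reindexing.\<close>

lemma det_kernel_mat_map:
  assumes "bij_betw f {..<m} J"
  shows "det (kernel_mat k (map (\<lambda>i. xs ! f i) [0..<m]) (map (\<lambda>i. xs ! f i) [0..<m])) =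
    principal_minor (\<lambda>i j. k (xs ! i) (xs ! j)) J"
proof -
  let ?ys = "map (\<lambda>i. xs ! f i) [0..<m]"
  have "det (kernel_mat k ?ys ?ys) = principal_minor (\<lambda>i j. kernel_mat k ?ys ?ys $$ (i, j)) {..<m}"
    using kernel_mat_carrier[of k ?ys ?ys] by (intro det_eq_principal_minor) simp
  also have "\<dots> = principal_minor (\<lambda>i j. k (xs ! f i) (xs ! f j)) {..<m}"
    by (rule principal_minor_cong) auto
  also have "\<dots> = principal_minor (\<lambda>i j. k (xs ! i) (xs ! j)) J"
    by (rule principal_minor_reindex[OF assms, symmetric]) simp
  finally show ?thesis .
qed

lemma det_kernel_mat_nths:
  assumes I: "I \<subseteq> {..<length xs}"
  shows "det (kernel_mat k (nths xs I) (nths xs I)) = principal_minor (\<lambda>i j. k (xs ! i) (xs ! j)) I"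
  unfolding nths_conv_map_pick[OF I]
  by (rule det_kernel_mat_map[OF pick_bij_betw]) (use I finite_subset in blast)

text \<open>The new index stands last instead of at its place in increasing order. The enumeration
  \<open>pick I\<close>, extended by the value \<open>j\<close>, is still a bijection onto
  \<open>insert j I\<close>.\<close>

lemma det_kernel_mat_nths_snoc:
  assumes I: "I \<subseteq> {..<length xs}" and j: "j \<notin> I"
  shows "det (kernel_mat k (nths xs I @ [xs ! j]) (nths xs I @ [xs ! j])) =
    principal_minor (\<lambda>i j. k (xs ! i) (xs ! j)) (insert j I)"
proof -
  have fin: "finite I" using I finite_subset by blast
  let ?f = "(pick I)(card I := j)"
  have "bij_betw ?f (insert (card I) {..<card I}) (insert j I)"
    unfolding notIn_Un_bij_betw3[symmetric]
  proof -
    have "bij_betw ?f {..<card I} I"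
      using pick_bij_betw[OF fin] by (rule bij_betw_cong[THEN iffD1, rotated]) auto
    then show "bij_betw ?f (insert (card I) {..<card I}) (insert j I)"
      using notIn_Un_bij_betw[of "card I" "{..<card I}" ?f I] j by simp
  qed
  then have bij: "bij_betw ?f {..<Suc (card I)} (insert j I)"
    by (simp add: lessThan_Suc)
  have "nths xs I @ [xs ! j] = map (\<lambda>i. xs ! ?f i) [0..<Suc (card I)]"
    by (simp add: nths_conv_map_pick[OF I])
  then show ?thesis
    using det_kernel_mat_map[OF bij, of k xs] by simp
qed

text \<open>Two rows coincide. This removes the control points themselves from the trace.\<close>

lemma det_kernel_mat_snoc_member:
  assumes x: "x \<in> set cs"
  shows "det (kernel_mat k (cs @ [x]) (cs @ [x])) = 0"
proof -
  obtain a where a: "a < length cs" "cs ! a = x" using x by (auto simp: in_set_conv_nth)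
  have c: "kernel_mat k (cs @ [x]) (cs @ [x]) \<in> carrier_mat (Suc (length cs)) (Suc (length cs))"
    using kernel_mat_carrier[of k "cs @ [x]" "cs @ [x]"] by simp
  show ?thesis
    by (rule det_identical_rows[OF c, of a "length cs"])
       (use a in \<open>auto intro!: eq_vecI simp: nth_append\<close>)
qed

lemma det_mult_mtrace_residual:
  assumes k: "pos_def_kernel k" and xs: "distinct xs" and I: "I \<subseteq> {..<length xs}"
  shows "det (kernel_mat k (nths xs I) (nths xs I)) * mtrace (kernel_mat k xs xs - Q_mat k xs (nths xs I)) =
    (\<Sum>j\<in>{..<length xs} - I. principal_minor (\<lambda>i j. k (xs ! i) (xs ! j)) (insert j I))"
proof -
  let ?cs = "nths xs I" and ?n = "length xs"
  have P: "pos_def_mat (kernel_mat k ?cs ?cs)"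
    by (rule pos_def_kernel_mat[OF k distinct_nthsI[OF xs]])
  have inv: "minv (kernel_mat k ?cs ?cs) \<in> carrier_mat (length ?cs) (length ?cs)"
    using minv_inverse(1)[OF kernel_mat_carrier, of k ?cs] pos_def_mat_det_pos[OF P] by auto
  have "det (kernel_mat k ?cs ?cs) * mtrace (kernel_mat k xs xs - Q_mat k xs ?cs) =
     (\<Sum>j<?n. det (kernel_mat k ?cs ?cs) * (kernel_mat k xs xs - Q_mat k xs ?cs) $$ (j, j))"
    using Q_mat_carrier[OF inv, of xs] by (simp add: mtrace_def sum_distrib_left del: index_minus_mat(1))
  also have "\<dots> = (\<Sum>j<?n. det (kernel_mat k (?cs @ [xs ! j]) (?cs @ [xs ! j])))"
    unfolding det_kernel_mat_snoc[OF P, symmetric]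
    using Q_mat_carrier[OF inv, of xs] by (intro sum.cong refl) (simp add: Q_mat_index[OF inv])
  also have "\<dots> = (\<Sum>j\<in>{..<?n} - I. det (kernel_mat k (?cs @ [xs ! j]) (?cs @ [xs ! j])))"
    by (rule sum.mono_neutral_right) (auto intro!: det_kernel_mat_snoc_member simp: set_nths)
  also have "\<dots> = (\<Sum>j\<in>{..<?n} - I. principal_minor (\<lambda>i j. k (xs ! i) (xs ! j)) (insert j I))"
    by (intro sum.cong refl det_kernel_mat_nths_snoc[OF I]) simp
  finally show ?thesis .
qed

text \<open>Double counting: a set \<open>J\<close> of size \<open>Suc m\<close> arises as
  \<open>insert j I\<close> once for each of its elements \<open>j\<close>, with
  \<open>I = J - {j}\<close>.\<close>

lemma sum_subsets_insert:
  fixes f :: "nat set \<Rightarrow> real"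
  shows "(\<Sum>I | I \<subseteq> {..<n} \<and> card I = m. \<Sum>j\<in>{..<n} - I. f (insert j I)) =
    (real m + 1) * (\<Sum>J | J \<subseteq> {..<n} \<and> card J = Suc m. f J)"
proof -
  let ?P = "\<lambda>m. {J. J \<subseteq> {..<n} \<and> card J = m}"
  have fin: "finite (?P m)" for m
    by (rule finite_subset[of _ "Pow {..<n}"]) auto
  have finJ: "finite J" if "J \<subseteq> {..<n}" for J
    using that by (rule finite_subset) simp
  have "(\<Sum>I\<in>?P m. \<Sum>j\<in>{..<n} - I. f (insert j I)) =
      (\<Sum>(I, j)\<in>Sigma (?P m) (\<lambda>I. {..<n} - I). f (insert j I))"
    by (rule sum.Sigma) (use fin in auto)
  also have "\<dots> = (\<Sum>(J, j)\<in>Sigma (?P (Suc m)) (\<lambda>J. J). f J)"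
    by (rule sum.reindex_bij_witness[where i = "\<lambda>(J, j). (J - {j}, j)" and j = "\<lambda>(I, j). (insert j I, j)"])
       (auto simp: finJ insert_absorb)
  also have "\<dots> = (\<Sum>J\<in>?P (Suc m). \<Sum>j\<in>J. f J)"
    by (rule sum.Sigma[symmetric]) (use fin finJ in auto)
  also have "\<dots> = (\<Sum>J\<in>?P (Suc m). (real m + 1) * f J)"
    by (intro sum.cong refl) auto
  finally show ?thesis by (simp add: sum_distrib_left)
qed

text \<open>As \<open>m\<close> is at most the dimension, \<open>{..<m}\<close> is an admissible set
  with positive minor. The normalising sum is then positive and the expectation is a finite weighted
  sum.\<close>

lemma expectation_dpp:
  assumes m: "m \<le> dim_row A"
    and minors: "\<And>J. J \<subseteq> {..<dim_row A} \<Longrightarrow> 0 < det (submatrix A J J)"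
  shows "measure_pmf.expectation (dpp m A) f =
    (\<Sum>I | I \<subseteq> {..<dim_row A} \<and> card I = m. det (submatrix A I I) * f I) /
    (\<Sum>J | J \<subseteq> {..<dim_row A} \<and> card J = m. det (submatrix A J J))"
    and "0 < (\<Sum>J | J \<subseteq> {..<dim_row A} \<and> card J = m. det (submatrix A J J))"
    and "finite (set_pmf (dpp m A))"
proof -
  let ?S = "{J. J \<subseteq> {..<dim_row A} \<and> card J = m}"
  let ?Z = "\<Sum>J\<in>?S. det (submatrix A J J)"
  have fin: "finite ?S"
    by (rule finite_subset[of _ "Pow {..<dim_row A}"]) auto
  have "{..<m} \<in> ?S" using m by auto
  then show Z: "0 < ?Z"
    by (rule sum_pos2[OF fin]) (use minors m in \<open>auto intro: less_imp_le\<close>)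
  have pmf: "pmf (dpp m A) I = (if I \<in> ?S then det (submatrix A I I) / ?Z else 0)" for I
    unfolding mem_Collect_eq by (rule pmf_dpp[OF less_imp_le[OF minors] Z])
  have "set_pmf (dpp m A) \<subseteq> ?S" by (auto simp: set_pmf_eq pmf)
  then show "finite (set_pmf (dpp m A))" using fin by (rule finite_subset)
  have "measure_pmf.expectation (dpp m A) f = (\<Sum>I\<in>?S. f I * pmf (dpp m A) I)"
    by (rule integral_measure_pmf_real[OF fin]) (auto simp: set_pmf_eq pmf split: if_splits)
  also have "\<dots> = (\<Sum>I\<in>?S. det (submatrix A I I) * f I / ?Z)"
    by (intro sum.cong refl) (simp add: pmf)
  finally show "measure_pmf.expectation (dpp m A) f = (\<Sum>I\<in>?S. det (submatrix A I I) * f I) / ?Z"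
    by (simp add: sum_divide_distrib)
qed

lemma det_submatrix_kernel_mat_pos:
  assumes "pos_def_kernel k" "distinct xs"
  shows "0 < det (submatrix (kernel_mat k xs xs) J J)"
  unfolding submatrix_kernel_mat
  by (rule pos_def_mat_det_pos[OF pos_def_kernel_mat[OF assms(1) distinct_nthsI[OF assms(2)]]])

text \<open>By double counting the numerator of the expectation is \<open>m + 1\<close> times the
  sum of the minors of size \<open>Suc m\<close>. Both minor sums are elementary symmetric in the
  eigenvalues, so the normaliser cancels and the tail sum remains.\<close>

lemma expectation_dpp_mtrace_le:
  assumes k: "pos_def_kernel k" and xs: "distinct xs" and m: "m \<le> length xs"
  shows "measure_pmf.expectation (dpp m (kernel_mat k xs xs))
      (\<lambda>I. mtrace (kernel_mat k xs xs - Q_mat k xs (nths xs I)))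
    \<le> (real m + 1) * (\<Sum>i=m+1..length xs. eigval (kernel_mat k xs xs) i)"
proof -
  let ?A = "kernel_mat k xs xs" and ?n = "length xs"
  let ?P = "\<lambda>m. {J. J \<subseteq> {..<?n} \<and> card J = m}"
  let ?d = "principal_minor (\<lambda>i j. k (xs ! i) (xs ! j))"
  have A: "pos_def_mat ?A" by (rule pos_def_kernel_mat[OF k xs])
  have minors: "det (submatrix ?A J J) = ?d J" if "J \<subseteq> {..<?n}" for J
    unfolding submatrix_kernel_mat by (rule det_kernel_mat_nths[OF that])
  note pos = det_submatrix_kernel_mat_pos[OF k xs]
  have minor_sum: "(\<Sum>J\<in>?P m. ?d J) = (\<Sum>J\<in>?P m. \<Prod>j\<in>J. eigval ?A (Suc j))" for m
  proof -
    have "(\<Sum>J\<in>?P m. ?d J) = (\<Sum>J\<in>?P m. principal_minor (\<lambda>i j. ?A $$ (i, j)) J)"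
      by (intro sum.cong refl principal_minor_cong) (auto simp: subset_eq)
    also have "\<dots> = (\<Sum>J\<in>?P m. \<Prod>j\<in>J. eigval ?A (Suc j))"
      using char_poly_eq_prod_eigval(1)[OF kernel_mat_carrier] pos_def_matD(2)[OF A]
      by (intro sum_principal_minors_eq_elementary_symmetric[OF kernel_mat_carrier]) auto
    finally show ?thesis .
  qed
  have Z: "(\<Sum>J\<in>?P m. det (submatrix ?A J J)) = (\<Sum>J\<in>?P m. ?d J)"
    by (intro sum.cong refl minors) auto
  have Zpos: "0 < (\<Sum>J\<in>?P m. ?d J)"
    using expectation_dpp(2)[of m ?A] m pos by (simp add: Z)
  have "measure_pmf.expectation (dpp m ?A) (\<lambda>I. mtrace (?A - Q_mat k xs (nths xs I))) =
      (\<Sum>I\<in>?P m. det (submatrix ?A I I) * mtrace (?A - Q_mat k xs (nths xs I))) / (\<Sum>J\<in>?P m. ?d J)"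
    using expectation_dpp(1)[of m ?A] m pos by (simp add: Z)
  also have "(\<Sum>I\<in>?P m. det (submatrix ?A I I) * mtrace (?A - Q_mat k xs (nths xs I))) =
      (\<Sum>I\<in>?P m. \<Sum>j\<in>{..<?n} - I. ?d (insert j I))"
    by (intro sum.cong refl)
       (simp add: submatrix_kernel_mat det_mult_mtrace_residual[OF k xs])
  also have "\<dots> = (real m + 1) * (\<Sum>J\<in>?P (Suc m). ?d J)"
    by (rule sum_subsets_insert)
  also have "\<dots> \<le> (real m + 1) * ((\<Sum>J\<in>?P m. ?d J) * (\<Sum>i=m..<?n. eigval ?A (Suc i)))"
    unfolding minor_sum
    by (intro mult_left_mono elementary_symmetric_Suc_le)
       (use pos_def_mat_eigval_pos[OF A] in \<open>auto intro: less_imp_le\<close>)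
  \<comment> \<open>Passes from 0-based positions to the numbering of \<open>eigval\<close>, which
    starts at 1.\<close>
  also have "(\<Sum>i=m..<?n. eigval ?A (Suc i)) = (\<Sum>i=m+1..?n. eigval ?A i)"
    by (simp add: sum.shift_bounds_Suc_ivl[symmetric] atLeastLessThanSuc_atLeastAtMost)
  finally show ?thesis
    using Zpos by (simp add: divide_right_mono)
qed

theorem theorem5p1:
  fixes k :: "'x::topological_space \<Rightarrow> 'x \<Rightarrow> real"
    and V :: "('x \<Rightarrow> real^'p) set"
    and ip :: "('x \<Rightarrow> real^'p) \<Rightarrow> ('x \<Rightarrow> real^'p) \<Rightarrow> real"
    and \<mu> :: "('x \<Rightarrow> real^'p) \<Rightarrow> real"
  assumes "pos_def_kernel k"
    and "vector_rkhs V ip (scalar_kernel k)"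
    and "\<forall>v\<in>V. continuous_on UNIV v"
  shows "\<exists>C>0. \<forall>(xs::'x list) (\<alpha>::nat \<Rightarrow> real^'p).
    distinct xs \<and> (\<forall>v\<in>V. \<mu> v = dirac_sum xs \<alpha> v) \<longrightarrow>
    (let n = length xs;
         A = kernel_mat k xs xs;
         err = (\<lambda>cs. dual_norm V ip (\<lambda>v. \<mu> v - compressed_functional k xs \<alpha> cs v))
     in
       (\<forall>cs. distinct cs \<and> set cs \<subseteq> set xs \<longrightarrow>
          (err cs)\<^sup>2 \<le> C * mtrace (A - Q_mat k xs cs)) \<and>
       (\<forall>m\<le>n.
          measure_pmf.expectation (dpp m A) (\<lambda>I. (err (nths xs I))\<^sup>2)
            \<le> C * (real m + 1) * (\<Sum>i = m + 1..n. eigval A i)) \<and>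
       (\<forall>c rls S \<delta>. rls_scheme c rls \<and> 1 \<le> S \<and> 0 < \<delta> \<and> \<delta> < 1 / 32 \<longrightarrow>
          measure_pmf.prob (rls A S \<delta>)
            {I. real (length (nths xs I)) \<le> c * real S * ln (real S / \<delta>) \<and>
                (err (nths xs I))\<^sup>2 \<le> C * real n / real S * (\<Sum>i = S + 1..n. eigval A i)}
            \<ge> 1 - 3 * \<delta>))"
proof -
  interpret scalar_rkhs V ip k
    using assms(1,2) by (simp add: scalar_rkhs_def scalar_rkhs_axioms_def)
  let ?rep = "\<lambda>(xs, \<alpha> :: nat \<Rightarrow> real^'p). distinct xs \<and> (\<forall>v\<in>V. \<mu> v = dirac_sum xs \<alpha> v)"
  let ?sq = "\<lambda>(xs :: 'x list, \<alpha> :: nat \<Rightarrow> real^'p). \<Sum>i<length xs. (norm (\<alpha> i))\<^sup>2"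
  (* If mu has no representation at all, SOME yields junk, but then nothing is claimed. *)
  define C where "C = 1 + ?sq (SOME r. ?rep r)"
  \<comment> \<open>The summand 1 keeps \<open>C\<close> positive even if the squared coefficient
    sum is 0.\<close>
  have C_pos: "0 < C"
    by (auto simp: C_def split: prod.split intro!: add_pos_nonneg sum_nonneg)
  \<comment> \<open>All representations of \<open>\<mu>\<close> share the same squared coefficient
    sum, so the value at the chosen one controls every other.\<close>
  have C: "?sq (xs, \<alpha>) \<le> C" if rep: "?rep (xs, \<alpha>)" for xs \<alpha>
  proof -
    obtain ys \<beta> where ys: "(SOME r. ?rep r) = (ys, \<beta>)" by fastforce
    have "?rep (SOME r. ?rep r)" by (rule someI[of ?rep]) (rule rep)
    then have "?rep (ys, \<beta>)" by (simp only: ys)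
    then have "?sq (xs, \<alpha>) = ?sq (ys, \<beta>)"
      using rep sum_norm_coefficients_unique[of xs ys \<alpha> \<beta>] by simp
    then show ?thesis by (simp add: C_def ys)
  qed
  show ?thesis
  proof (rule exI[of _ C], intro conjI allI impI)
    show "0 < C" by (rule C_pos)
  next
    fix xs :: "'x list" and \<alpha> :: "nat \<Rightarrow> real^'p"
    assume rep: "distinct xs \<and> (\<forall>v\<in>V. \<mu> v = dirac_sum xs \<alpha> v)"
    then have xs: "distinct xs" and \<mu>: "\<And>v. v \<in> V \<Longrightarrow> \<mu> v = dirac_sum xs \<alpha> v" by auto
    have sq: "(\<Sum>i<length xs. (norm (\<alpha> i))\<^sup>2) \<le> C" using C[of xs \<alpha>] rep by simp
    define n where "n = length xs"
    define A where "A = kernel_mat k xs xs"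
    define err where "err = (\<lambda>cs. dual_norm V ip (\<lambda>v. \<mu> v - compressed_functional k xs \<alpha> cs v))"
    have A: "pos_def_mat A" unfolding A_def by (rule pos_def_kernel_mat[OF pos_def xs])
    have trace: "(err cs)\<^sup>2 \<le> C * mtrace (A - Q_mat k xs cs)" if cs: "distinct cs" for cs
    proof -
      have "0 \<le> mtrace (A - Q_mat k xs cs)"
        unfolding A_def by (rule mtrace_residual_nonneg[OF cs])
      then have "mtrace (A - Q_mat k xs cs) * (\<Sum>i<length xs. (norm (\<alpha> i))\<^sup>2) \<le> mtrace (A - Q_mat k xs cs) * C"
        by (rule mult_left_mono[OF sq])
      then show ?thesis
        using order_trans[OF error_sq_le_trace[OF cs \<mu>]] by (simp add: err_def A_def mult.commute)
    qed
    have dpp: "measure_pmf.expectation (dpp m A) (\<lambda>I. (err (nths xs I))\<^sup>2)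
        \<le> C * (real m + 1) * (\<Sum>i = m + 1..n. eigval A i)" if m: "m \<le> n" for m
    proof -
      \<comment> \<open>Finite support makes both integrands integrable, as monotonicity of the
        expectation requires.\<close>
      have "finite (set_pmf (dpp m A))"
        by (rule expectation_dpp(3)) (use m det_submatrix_kernel_mat_pos[OF pos_def xs] in \<open>auto simp: A_def n_def\<close>)
      note integrable = integrable_measure_pmf_finite[OF this]
      have "measure_pmf.expectation (dpp m A) (\<lambda>I. (err (nths xs I))\<^sup>2) \<le>
          measure_pmf.expectation (dpp m A) (\<lambda>I. C * mtrace (A - Q_mat k xs (nths xs I)))"
        by (rule integral_mono[OF integrable integrable trace[OF distinct_nthsI[OF xs]]])
      also have "\<dots> = C * measure_pmf.expectation (dpp m A) (\<lambda>I. mtrace (A - Q_mat k xs (nths xs I)))"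
        by simp
      also have "\<dots> \<le> C * ((real m + 1) * (\<Sum>i = m + 1..n. eigval A i))"
        using expectation_dpp_mtrace_le[OF pos_def xs m[unfolded n_def]] C_pos
        by (simp add: A_def n_def)
      finally show ?thesis by (simp add: mult.assoc)
    qed
    have rls: "measure_pmf.prob (rls A S \<delta>)
        {I. real (length (nths xs I)) \<le> c * real S * ln (real S / \<delta>) \<and>
            (err (nths xs I))\<^sup>2 \<le> C * real n / real S * (\<Sum>i = S + 1..n. eigval A i)} \<ge> 1 - 3 * \<delta>"
      if asm: "rls_scheme c rls \<and> 1 \<le> S \<and> 0 < \<delta> \<and> \<delta> < 1 / 32" for c rls S \<delta>
    proof -
      let ?good = "{I. real (card I) \<le> c * real S * ln (real S / \<delta>) \<and>
          spectral_norm (A - submatrix A UNIV I * minv (submatrix A I I) * submatrix A I UNIV)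
            \<le> 1 / real S * (\<Sum>i = S + 1..n. eigval A i)}"
      let ?goal = "{I. real (length (nths xs I)) \<le> c * real S * ln (real S / \<delta>) \<and>
            (err (nths xs I))\<^sup>2 \<le> C * real n / real S * (\<Sum>i = S + 1..n. eigval A i)}"
      have n: "dim_row A = n" by (simp add: A_def n_def)
      have supp: "set_pmf (rls A S \<delta>) \<subseteq> Pow {..<n}"
        and prob: "1 - 3 * \<delta> \<le> measure_pmf.prob (rls A S \<delta>) ?good"
        using asm A unfolding rls_scheme_def n[symmetric] by blast+
      have S: "1 \<le> real S" using asm by simp
      define \<Lambda> where "\<Lambda> = (\<Sum>i = S + 1..n. eigval A i)"
      have \<Lambda>0: "0 \<le> \<Lambda>"
        unfolding \<Lambda>_def
      proof (rule sum_nonneg)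
        fix i assume "i \<in> {S + 1..n}"
        then show "0 \<le> eigval A i"
          using pos_def_mat_eigval_pos[OF A, of "i - 1"] n by fastforce
      qed
      \<comment> \<open>The spectral norm argument yields \<open>\<Lambda> / real S * C\<close>;
        this comparison brings in the factor \<open>n\<close> of the claim. For \<open>n = 0\<close>
        the eigenvalue sum is empty.\<close>
      have \<Lambda>n: "\<Lambda> \<le> real n * \<Lambda>"
      proof (cases "n = 0")
        case True
        then show ?thesis by (simp add: \<Lambda>_def)
      next
        case False
        then show ?thesis using \<Lambda>0 by (simp add: mult_le_cancel_right1)
      qed
      have "I \<in> ?goal" if I: "I \<in> set_pmf (rls A S \<delta>)" and good: "I \<in> ?good" for I
      proof -
        let ?cs = "nths xs I"
        have cs: "distinct ?cs" by (rule distinct_nthsI[OF xs])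
        have sub: "I \<subseteq> {..<length xs}" using I supp by (auto simp: n_def)
        then have card: "length ?cs = card I"
          by (simp add: nths_conv_map_pick)
        have "submatrix A UNIV I * minv (submatrix A I I) * submatrix A I UNIV = Q_mat k xs ?cs"
          unfolding A_def submatrix_kernel_mat Q_mat_def by (simp add: nths_all)
        then have spec: "spectral_norm (A - Q_mat k xs ?cs) \<le> \<Lambda> / real S"
          using good by (simp add: \<Lambda>_def)
        have "(err ?cs)\<^sup>2 \<le> spectral_norm (A - Q_mat k xs ?cs) * (\<Sum>i<length xs. (norm (\<alpha> i))\<^sup>2)"
          unfolding err_def A_def by (rule error_sq_le_spectral_norm[OF cs \<mu>])
        also have "\<dots> \<le> \<Lambda> / real S * (\<Sum>i<length xs. (norm (\<alpha> i))\<^sup>2)"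
          by (rule mult_right_mono[OF spec]) (simp add: sum_nonneg)
        also have "\<dots> \<le> \<Lambda> / real S * C"
          by (rule mult_left_mono[OF sq]) (use \<Lambda>0 in simp)
        also have "\<dots> \<le> real n * \<Lambda> / real S * C"
          using \<Lambda>n C_pos S by (intro mult_right_mono divide_right_mono) auto
        finally show ?thesis
          using good by (simp add: \<Lambda>_def card mult_ac)
      qed
      \<comment> \<open>The good event implies the claim only for sets of valid indices, where
        \<open>card I\<close> is the number of control points. Intersecting with the support secures
        this and leaves the probability unchanged.\<close>
      then have "?good \<inter> set_pmf (rls A S \<delta>) \<subseteq> ?goal" by blast
      then have "measure_pmf.prob (rls A S \<delta>) (?good \<inter> set_pmf (rls A S \<delta>)) \<le> measure_pmf.prob (rls A S \<delta>) ?goal"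
        by (rule measure_pmf.finite_measure_mono) simp
      then show ?thesis
        using prob by (simp add: measure_Int_set_pmf)
    qed
    show "let n = length xs;
         A = kernel_mat k xs xs;
         err = (\<lambda>cs. dual_norm V ip (\<lambda>v. \<mu> v - compressed_functional k xs \<alpha> cs v))
     in
       (\<forall>cs. distinct cs \<and> set cs \<subseteq> set xs \<longrightarrow>
          (err cs)\<^sup>2 \<le> C * mtrace (A - Q_mat k xs cs)) \<and>
       (\<forall>m\<le>n.
          measure_pmf.expectation (dpp m A) (\<lambda>I. (err (nths xs I))\<^sup>2)
            \<le> C * (real m + 1) * (\<Sum>i = m + 1..n. eigval A i)) \<and>
       (\<forall>c rls S \<delta>. rls_scheme c rls \<and> 1 \<le> S \<and> 0 < \<delta> \<and> \<delta> < 1 / 32 \<longrightarrow>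
          measure_pmf.prob (rls A S \<delta>)
            {I. real (length (nths xs I)) \<le> c * real S * ln (real S / \<delta>) \<and>
                (err (nths xs I))\<^sup>2 \<le> C * real n / real S * (\<Sum>i = S + 1..n. eigval A i)}
            \<ge> 1 - 3 * \<delta>)"
      unfolding Let_def n_def[symmetric] A_def[symmetric] fun_cong[OF err_def, symmetric]
      using trace dpp rls by blast
  qed
qed

end
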